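(* Let $X$ be a compact Hausdorff space. Then $X$ is densely $k$-separable (that is, $\delta_k(X)\le\aleph_0$) if and only if $X$ has countable $\pi$-weight (that is, $\pi(X)\le\aleph_0$).
   Context: All topological spaces are regular Hausdorff. For a space $Y$, the compact covering number $\operatorname{cov}_k(Y)$ is the least cardinal $\tau$ such that $Y$ can be covered by $\tau$ many compact subsets of $Y$. For a space $X$, set $d_k(X)=\min\{\operatorname{cov}_k(Y) : Y \text{ is a dense subset of } X\}$ and $\delta_k(X)=\sup\{d_k(Y) : Y\text{ is a dense subset of }X\}$, where subsets carry the subspace topology. A space $X$ is densely $k$-separable if $\delta_k(X)\le\aleph_0$. A $\pi$-base for $X$ is a family of non-empty open sets such that every non-empty open subset of $X$ includes a member of the family; the $\pi$-weight $\pi(X)$ is the minimum cardinality of a $\pi$-base for $X$. *)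

theory Defs
  imports "HOL-Analysis.Analysis"
begin

unbundle cardinal_syntax

(* A cardinal is represented, up to \<open>=o\<close>, by a relation satisfying Card_order; \<open>\<le>o\<close> compares
   cardinals living on different types. Every family of sets occurring below consists of subsets
   of the carrier, so all the cardinals defined here are relations on 'a set. *)

definition min_card :: "'b rel set \<Rightarrow> 'b rel" where
  "min_card R = (SOME r. r \<in> R \<and> (\<forall>r'\<in>R. r \<le>o r'))"

(* The supremum is taken among cardinals on the same type 'b. This loses nothing: a cardinal on
   any type that is \<open>\<le>o\<close> some Card_order on 'b is \<open>=o\<close> to a Card_order on 'b. *)
definition sup_card :: "'b rel set \<Rightarrow> 'b rel" where
  "sup_card R = min_card {r. Card_order r \<and> (\<forall>r'\<in>R. r' \<le>o r)}"

definition cov_k :: "'a topology \<Rightarrow> 'a set rel" where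
  "cov_k Y = min_card {|\<K>| |\<K>. (\<forall>K\<in>\<K>. compactin Y K) \<and> \<Union>\<K> = topspace Y}"

definition dense_subset :: "'a topology \<Rightarrow> 'a set \<Rightarrow> bool" where
  "dense_subset X D \<longleftrightarrow> D \<subseteq> topspace X \<and> X closure_of D = topspace X"

definition d_k :: "'a topology \<Rightarrow> 'a set rel" where
  "d_k X = min_card {cov_k (subtopology X Y) |Y. dense_subset X Y}"

definition \<delta>_k :: "'a topology \<Rightarrow> 'a set rel" where
  "\<delta>_k X = sup_card {d_k (subtopology X Y) |Y. dense_subset X Y}"

definition densely_k_separable :: "'a topology \<Rightarrow> bool" where
  "densely_k_separable X \<longleftrightarrow> \<delta>_k X \<le>o natLeq"

definition pi_base :: "'a topology \<Rightarrow> 'a set set \<Rightarrow> bool" where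
  "pi_base X \<B> \<longleftrightarrow>
     (\<forall>B\<in>\<B>. openin X B \<and> B \<noteq> {}) \<and>
     (\<forall>U. openin X U \<and> U \<noteq> {} \<longrightarrow> (\<exists>B\<in>\<B>. B \<subseteq> U))"

definition pi_weight :: "'a topology \<Rightarrow> 'a set rel" where
  "pi_weight X = min_card {|\<B>| |\<B>. pi_base X \<B>}"

(* The choices above are always made from nonempty sets of cardinals. *)

lemma min_card_least:
  assumes "R \<noteq> {}" and "\<And>r. r \<in> R \<Longrightarrow> Card_order r"
  shows "min_card R \<in> R" and "r \<in> R \<Longrightarrow> min_card R \<le>o r"
proof -
  have "\<exists>r. r \<in> R \<and> (\<forall>r'\<in>R. r \<le>o r')"
    using exists_minim_Card_order[of R] assms by blast
  then have "min_card R \<in> R \<and> (\<forall>r'\<in>R. min_card R \<le>o r')"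
    unfolding min_card_def by (rule someI_ex)
  then show "min_card R \<in> R" and "r \<in> R \<Longrightarrow> min_card R \<le>o r" by blast+
qed

lemma sup_card_least_upper:
  fixes R :: "'b rel set" and s :: "'b rel"
  assumes "\<And>r. r \<in> R \<Longrightarrow> Card_order r"
  shows "Card_order (sup_card R)"
    and "r \<in> R \<Longrightarrow> r \<le>o sup_card R"
    and "Card_order s \<Longrightarrow> (\<And>r. r \<in> R \<Longrightarrow> r \<le>o s) \<Longrightarrow> sup_card R \<le>o s"
proof -
  let ?U = "{r :: 'b rel. Card_order r \<and> (\<forall>r'\<in>R. r' \<le>o r)}"
  have "r' \<le>o |UNIV :: 'b set|" if "r' \<in> R" for r'
    using card_of_Field_ordIso[OF assms[OF that]] card_of_mono1[OF subset_UNIV[of "Field r'"]]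
      ordIso_ordLeq_trans ordIso_symmetric by blast
  then have "|UNIV :: 'b set| \<in> ?U" by (simp add: card_of_Card_order)
  then have ne: "?U \<noteq> {}" by blast
  have "sup_card R \<in> ?U"
    unfolding sup_card_def by (rule min_card_least(1)[OF ne]) simp
  then show "Card_order (sup_card R)" and "r \<in> R \<Longrightarrow> r \<le>o sup_card R" by auto
  assume "Card_order s" and "\<And>r. r \<in> R \<Longrightarrow> r \<le>o s"
  then show "sup_card R \<le>o s"
    unfolding sup_card_def by (intro min_card_least(2)[OF ne]) auto
qed

lemma cov_k_set_nonempty:
  "{|\<K>| |\<K>. (\<forall>K\<in>\<K>. compactin Y K) \<and> \<Union>\<K> = topspace Y} \<noteq> {}"
proof -
  have "\<forall>K\<in>(\<lambda>x. {x}) ` topspace Y. compactin Y K" by simp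
  moreover have "\<Union>((\<lambda>x. {x}) ` topspace Y) = topspace Y" by auto
  ultimately show ?thesis by blast
qed

lemma Card_order_cov_k: "Card_order (cov_k Y)"
proof -
  have "cov_k Y \<in> {|\<K>| |\<K>. (\<forall>K\<in>\<K>. compactin Y K) \<and> \<Union>\<K> = topspace Y}"
    unfolding cov_k_def
    by (rule min_card_least(1)[OF cov_k_set_nonempty]) (auto simp: card_of_Card_order)
  then show ?thesis by (auto simp: card_of_Card_order)
qed

lemma dense_subset_topspace: "dense_subset X (topspace X)"
  by (simp add: dense_subset_def)

lemma Card_order_d_k: "Card_order (d_k X)"
proof -
  have "{cov_k (subtopology X Y) |Y. dense_subset X Y} \<noteq> {}"
    using dense_subset_topspace by blast
  then have "d_k X \<in> {cov_k (subtopology X Y) |Y. dense_subset X Y}"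
    unfolding d_k_def by (rule min_card_least(1)) (auto simp: Card_order_cov_k)
  then show ?thesis by (auto simp: Card_order_cov_k)
qed

lemma pi_base_nonempty_opens: "pi_base X {U. openin X U \<and> U \<noteq> {}}"
  by (auto simp: pi_base_def)

end

theory Submission
  imports Defs "HOL-Library.Countable_Set_Type"
begin

text \<open>
  A countable \<open>\<pi>\<close>-base lets one pick a countable dense subset of every dense set, and singletons are
  compact, so only the converse is hard. Its hypothesis is used in the form: every dense set
  \<open>Y\<close> contains countably many compact sets whose union is dense (\<open>dense_sets_k_separable\<close>). Each use
  feeds it a dense set built so that compact subsets of it are small. The first use: if \<open>Y\<close> is
  the union of a maximal disjoint family of open sets, a compact subset of \<open>Y\<close> meets only finitely
  many members, so disjoint families of open sets are countable.

  \<^bold>\<open>Reduction to small spaces.\<close> A set \<open>\<Phi>\<close> of at most continuum many continuous real functions is closed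
  under enough countable operations to reflect two properties of \<open>X\<close>. The image \<open>Z\<close> of \<open>X\<close> in the
  power of the reals indexed by \<open>\<Phi>\<close> then has a \<open>\<pi>\<close>-base of size at most continuum; the images
  of nonempty open sets of \<open>X\<close> have nonempty interior in \<open>Z\<close>, so \<open>Z\<close> inherits the hypothesis; and a
  countable \<open>\<pi>\<close>-base of \<open>Z\<close> pulls back to one of \<open>X\<close>
  (\<open>k_separable_imp_countable_pi_base\<close>).

  \<^bold>\<open>A map with large images.\<close> When the \<open>\<pi>\<close>-base has size at most continuum, there is a single
  continuous map \<open>f\<close> into the sequences of reals that separates isolated points and has infinite image
  on every nonempty open set without isolated points (\<open>exists_rich_map\<close>). Images of closures of
  such sets are compact and perfect, so they have continuum many points, and a transfinite recursion assigns
  distinct values \<open>r\<^sub>B\<close>, attained inside \<open>B\<close>, to the members \<open>B\<close> of the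
  \<open>\<pi>\<close>-base without isolated points. Whatever points \<open>y\<^sub>B \<in> B\<close> are chosen in
  the fibres over the \<open>r\<^sub>B\<close>, the isolated points and the \<open>y\<^sub>B\<close> form a dense set
  on which \<open>f\<close> is injective. Its compact subsets are therefore metrizable, hence separable, and the
  hypothesis makes countably many of these points dense.

  \<^bold>\<open>Greedy choice in the fibres.\<close> The freedom in choosing \<open>y\<^sub>B\<close> is spent on a well-ordered
  family of regular open sets \<open>E\<^sub>s\<close>: the point \<open>y\<^sub>B\<close> avoids \<open>E\<^sub>s\<close>, for \<open>s\<close> in increasing order,
  whenever compactness permits. If \<open>y\<^sub>B \<in> E\<^sub>s\<close>, the reason is that a neighbourhood of the fibre, intersected with the
  exteriors of finitely many earlier \<open>E\<^sub>t\<close>, is already inside \<open>E\<^sub>s\<close>. As countably many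
  isolated points and points \<open>y\<^sub>B\<close> are dense, countably many open sets \<open>c\<close> suffice to find, for every \<open>s\<close>, a nonempty set
  \<open>c \<inter> ext E\<^sub>t\<^sub>1 \<inter> \<dots> \<inter> ext E\<^sub>t\<^sub>n \<subseteq> E\<^sub>s\<close> with all \<open>t\<^sub>i < s\<close>
  (\<open>k_separable_countably_refinable\<close>).

  \<^bold>\<open>Descent in the algebra of regular open sets.\<close> Well-order the regular open sets and apply the previous step
  to the sets \<open>p \<inter> v\<close> and \<open>p \<inter> ext v\<close>, where \<open>p\<close> is generated by sets before \<open>v\<close> and by countably many sets
  found so far. After \<open>\<omega>\<close> rounds there is a countable set \<open>C\<close> such that below every nonempty set
  generated from \<open>C\<close> and from sets up to \<open>v\<close> lies a nonempty set generated from \<open>C\<close> and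
  from sets strictly before \<open>v\<close>. Such a set involves only finitely many generators, so the descent
  ends in the countable algebra generated by \<open>C\<close>, whose nonempty members form a \<open>\<pi>\<close>-base
  (\<open>countable_refinement_of_regular_opens\<close>).
\<close>

section \<open>Exteriors and regular open sets\<close>

definition exterior_of :: "'a topology \<Rightarrow> 'a set \<Rightarrow> 'a set" (infixr \<open>exterior'_of\<close> 80) where
  "X exterior_of U = topspace X - X closure_of U"

lemma openin_exterior_of [simp]: "openin X (X exterior_of U)"
  by (simp add: exterior_of_def openin_diff)

lemma exterior_of_subset_topspace: "X exterior_of U \<subseteq> topspace X"
  by (simp add: exterior_of_def)

lemma exterior_of_disjoint: "U \<subseteq> topspace X \<Longrightarrow> U \<inter> X exterior_of U = {}"
  using closure_of_subset[of U X] by (auto simp: exterior_of_def)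

text \<open>
  Together with \<open>exterior_of_disjoint\<close> this characterizes the exterior as the largest open set disjoint from \<open>U\<close>.
\<close>
lemma exterior_of_maximal: "openin X V \<Longrightarrow> V \<inter> U = {} \<Longrightarrow> V \<subseteq> X exterior_of U"
  unfolding exterior_of_def
  using openin_Int_closure_of_eq_empty[of X V U] openin_subset[of X V] by auto

lemma exterior_of_mono: "U \<subseteq> V \<Longrightarrow> X exterior_of V \<subseteq> X exterior_of U"
  using closure_of_mono[of U V X] by (auto simp: exterior_of_def)

text \<open>Taking the exterior twice gives the interior of the closure.\<close>
definition regular_open :: "'a topology \<Rightarrow> 'a set \<Rightarrow> bool" where
  "regular_open X U \<longleftrightarrow> X exterior_of (X exterior_of U) = U"

lemma regular_open_openin: "regular_open X U \<Longrightarrow> openin X U"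
  by (metis openin_exterior_of regular_open_def)

lemma open_subset_double_exterior: "openin X U \<Longrightarrow> U \<subseteq> X exterior_of (X exterior_of U)"
  by (simp add: exterior_of_disjoint exterior_of_maximal openin_subset)

lemma regular_open_exterior_of: 
  assumes "openin X U" shows "regular_open X (X exterior_of U)"
  unfolding regular_open_def
  by (intro subset_antisym exterior_of_mono open_subset_double_exterior assms) simp

lemma regular_open_Int:
  assumes "regular_open X U" "regular_open X V" shows "regular_open X (U \<inter> V)"
  unfolding regular_open_def
proof (rule subset_antisym)
  show "U \<inter> V \<subseteq> X exterior_of (X exterior_of (U \<inter> V))"
    by (intro open_subset_double_exterior openin_Int regular_open_openin assms)
  show "X exterior_of (X exterior_of (U \<inter> V)) \<subseteq> U \<inter> V"
    using assms exterior_of_mono[OF exterior_of_mono, of "U \<inter> V" U X X] 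
       exterior_of_mono[OF exterior_of_mono, of "U \<inter> V" V X X] 
    unfolding regular_open_def by blast
qed

lemma regular_open_topspace: "regular_open X (topspace X)"
  by (simp add: regular_open_def exterior_of_def)

section \<open>Subalgebras of the algebra of regular open sets\<close>

text \<open>
  The subalgebra generated by \<open>G\<close>: intersection is the meet and the exterior is the complement, so joins
  come for free by De Morgan.
\<close>
inductive_set reg_algebra :: "'a topology \<Rightarrow> 'a set set \<Rightarrow> 'a set set"
  for X :: "'a topology" and G :: "'a set set" where
  top: "topspace X \<in> reg_algebra X G"
| gen: "g \<in> G \<Longrightarrow> g \<in> reg_algebra X G"
| Int: "x \<in> reg_algebra X G \<Longrightarrow> y \<in> reg_algebra X G \<Longrightarrow> x \<inter> y \<in> reg_algebra X G"
| ext: "x \<in> reg_algebra X G \<Longrightarrow> X exterior_of x \<in> reg_algebra X G"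

lemma reg_algebra_regular:
  assumes "\<And>g. g \<in> G \<Longrightarrow> regular_open X g" and "x \<in> reg_algebra X G"
  shows "regular_open X x"
  using assms(2)
  by induction (auto simp: assms regular_open_topspace regular_open_Int regular_open_exterior_of regular_open_openin)

lemma reg_algebra_mono:
  assumes "G \<subseteq> H" shows "reg_algebra X G \<subseteq> reg_algebra X H"
proof
  fix x assume "x \<in> reg_algebra X G"
  then show "x \<in> reg_algebra X H"
    by induction (use assms in \<open>auto intro: reg_algebra.intros\<close>)
qed

lemma reg_algebra_finite_support:
  assumes "x \<in> reg_algebra X G"
  obtains F where "finite F" "F \<subseteq> G" "x \<in> reg_algebra X F"
proof -
  have "\<exists>F. finite F \<and> F \<subseteq> G \<and> x \<in> reg_algebra X F"
    using assms
  proof induction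
    case top then show ?case by (intro exI[of _ "{}"]) (auto intro: reg_algebra.intros)
  next
    case (gen g) then show ?case by (intro exI[of _ "{g}"]) (auto intro: reg_algebra.intros)
  next
    case (Int x y)
    then obtain F H where "finite F" "F \<subseteq> G" "x \<in> reg_algebra X F" 
       "finite H" "H \<subseteq> G" "y \<in> reg_algebra X H" by blast
    then show ?case
      using reg_algebra_mono[of F "F \<union> H" X] reg_algebra_mono[of H "F \<union> H" X]
      by (intro exI[of _ "F \<union> H"]) (auto intro: reg_algebra.intros)
  next
    case (ext x) then show ?case by (auto intro: reg_algebra.intros)
  qed
  then show ?thesis using that by blast
qed

lemma reg_algebra_finite_Inter:
  assumes "finite a" "\<And>t. t \<in> a \<Longrightarrow> h t \<in> reg_algebra X G"
  shows "topspace X \<inter> (\<Inter>t\<in>a. h t) \<in> reg_algebra X G"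
  using assms
proof (induction a)
  case empty then show ?case by (simp add: reg_algebra.top)
next
  case (insert t a)
  have "topspace X \<inter> (\<Inter>t\<in>insert t a. h t) = h t \<inter> (topspace X \<inter> (\<Inter>t\<in>a. h t))" by auto
  then show ?case using insert by (auto intro: reg_algebra.intros)
qed

lemma countable_reg_algebra:
  assumes "countable G" shows "countable (reg_algebra X G)"
proof -
  define step where "step A = A \<union> (\<lambda>(x,y). x \<inter> y) ` (A \<times> A) \<union> (exterior_of) X ` A" for A
  define B where "B n = (step ^^ n) (insert (topspace X) G)" for n
  have B0: "B 0 = insert (topspace X) G" and BS: "B (Suc n) = step (B n)" for n
    by (auto simp: B_def)
  have cB: "countable (B n)" for n
  proof (induction n)
    case 0 then show ?case using assms by (simp add: B0)
  next
    case (Suc n) then show ?case by (simp add: BS step_def)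
  qed
  have mono: "mono B" by (rule incseq_SucI) (auto simp: BS step_def)
  have "x \<in> (\<Union>n. B n)" if "x \<in> reg_algebra X G" for x
    using that
  proof induction
    case top have "topspace X \<in> B 0" by (simp add: B0) then show ?case by blast
  next
    case (gen g) then have "g \<in> B 0" by (simp add: B0) then show ?case by blast
  next
    case (Int x y)
    then obtain m n where "x \<in> B m" "y \<in> B n" by blast
    then have "x \<in> B (max m n)" "y \<in> B (max m n)" 
      using monoD[OF mono, of m "max m n"] monoD[OF mono, of n "max m n"] by auto
    then have "x \<inter> y \<in> B (Suc (max m n))" by (auto simp: BS step_def)
    then show ?case by blast
  next
    case (ext x)
    then obtain n where "x \<in> B n" by blast
    then have "X exterior_of x \<in> B (Suc n)" by (auto simp: BS step_def)
    then show ?case by blast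
  qed
  then have "reg_algebra X G \<subseteq> (\<Union>n. B n)" by blast
  moreover have "countable (\<Union>n. B n)" using cB by blast
  ultimately show ?thesis by (rule countable_subset)
qed

lemma exterior_of_relative:
  assumes "openin X x" "openin X p" "openin X w" "x \<inter> w = p \<inter> w"
  shows "X exterior_of x \<inter> w = X exterior_of p \<inter> w"
proof -
  have "X exterior_of x \<inter> w \<subseteq> X exterior_of p" 
    if "openin X x" "openin X p" "x \<inter> w = p \<inter> w" for x p
    using that assms(3) exterior_of_disjoint[OF openin_subset, of X x] 
    by (intro exterior_of_maximal openin_Int) auto
  then show ?thesis using assms by blast
qed

text \<open>
  Inside \<open>v\<close>, or inside its complement, the generator \<open>v\<close> acts as the unit or as zero and can be eliminated.
\<close>
lemma reg_algebra_insert: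
  assumes G: "\<And>g. g \<in> G \<Longrightarrow> regular_open X g" and v: "regular_open X v"
    and x: "x \<in> reg_algebra X (insert v G)" and w: "w = v \<or> w = X exterior_of v"
  shows "\<exists>p \<in> reg_algebra X G. x \<inter> w = p \<inter> w"
  using x
proof induction
  case top then show ?case by (auto intro: reg_algebra.intros)
next
  case (gen g)
  then consider "g \<in> G" | "g = v" "w = v" | "g = v" "w = X exterior_of v" using w by blast
  then show ?case
  proof cases
    case 1 then show ?thesis by (auto intro: reg_algebra.intros)
  next
    case 2 
    then show ?thesis using v regular_open_openin[OF v, THEN openin_subset] 
      by (intro bexI[of _ "topspace X"]) (auto intro: reg_algebra.intros)
  next
    case 3
    have "X exterior_of (topspace X) \<in> reg_algebra X G" 
      by (auto intro: reg_algebra.intros)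
    moreover have "X exterior_of (topspace X) = {}" by (simp add: exterior_of_def)
    moreover have "v \<inter> w = {}" 
      using 3 exterior_of_disjoint regular_open_openin[OF v, THEN openin_subset] by metis
    ultimately show ?thesis using 3 by (intro bexI[of _ "{}"]) auto
  qed
next
  case (Int x y)
  then obtain p q where "p \<in> reg_algebra X G" "x \<inter> w = p \<inter> w" "q \<in> reg_algebra X G" "y \<inter> w = q \<inter> w"
    by blast
  then show ?case by (intro bexI[of _ "p \<inter> q"]) (auto intro: reg_algebra.intros)
next
  case (ext x)
  then obtain p where p: "p \<in> reg_algebra X G" "x \<inter> w = p \<inter> w" by blast
  have "openin X w" using w v regular_open_openin by auto
  moreover have "openin X p" using reg_algebra_regular[OF G p(1)] regular_open_openin by auto
  moreover have "openin X x"
    using reg_algebra_regular[OF _ ext.hyps] G v regular_open_openin by blast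
  ultimately have "X exterior_of x \<inter> w = X exterior_of p \<inter> w" 
    using p(2) exterior_of_relative by blast
  then show ?case using p(1) reg_algebra.ext by blast
qed

section \<open>Descent along a well-order of the regular open sets\<close>

text \<open>
  Well-ordered families of nonempty regular open sets are refined by countably many sets, up to finite
  intersections with exteriors of earlier members of the family. The type argument is the index
  type of the families.
\<close>
definition countably_refinable :: "'a topology \<Rightarrow> 'b itself \<Rightarrow> bool" where
  "countably_refinable X _ \<longleftrightarrow>
     (\<forall>(S :: 'b set) r E. wf r \<longrightarrow> trans r \<longrightarrow> total r \<longrightarrow>
        (\<forall>s\<in>S. regular_open X (E s) \<and> E s \<noteq> {}) \<longrightarrow>
        (\<exists>C. countable C \<and> (\<forall>c\<in>C. regular_open X c) \<and>
          (\<forall>s\<in>S. \<exists>c\<in>C. \<exists>a. finite a \<and> a \<subseteq> {t\<in>S. (t, s) \<in> r} \<and>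
             c \<inter> (\<Inter>t\<in>a. X exterior_of (E t)) \<noteq> {} \<and>
             c \<inter> (\<Inter>t\<in>a. X exterior_of (E t)) \<subseteq> E s)))"

text \<open>
  Elimination of the largest generator: below \<open>p \<inter> \<sigma> v\<close>, where \<open>\<sigma> v\<close> is \<open>v\<close> or its complement and \<open>p\<close> is
  generated by earlier sets and by \<open>C\<close>, there is a nonempty set generated without \<open>v\<close>, once countably many sets
  \<open>C'\<close> are added. The family to be refined consists of all these \<open>p \<inter> \<sigma> v\<close>, ordered
  lexicographically with \<open>v\<close> first.
\<close>
lemma refine_step:
  fixes X :: "'a topology" and L :: "'a set rel"
  assumes R: "countably_refinable X TYPE('a set \<times> 'a set)"
    and L: "wf L" "trans L" "total L"
    and C: "\<And>c. c \<in> C \<Longrightarrow> regular_open X c"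
    and \<sigma>: "(\<forall>v. \<sigma> v = v) \<or> (\<forall>v. \<sigma> v = X exterior_of v)"
  defines "G \<equiv> \<lambda>v. {u. regular_open X u \<and> (u, v) \<in> L} \<union> C"
  shows "\<exists>C'. countable C' \<and> (\<forall>c\<in>C'. regular_open X c) \<and>
     (\<forall>v p. regular_open X v \<longrightarrow> p \<in> reg_algebra X (G v) \<longrightarrow> p \<inter> \<sigma> v \<noteq> {} \<longrightarrow>
       (\<exists>c\<in>C'. \<exists>r\<in>reg_algebra X (G v). c \<inter> r \<noteq> {} \<and> c \<inter> r \<subseteq> p \<inter> \<sigma> v))"
proof -
  define S where "S = {(v, p). regular_open X v \<and> p \<in> reg_algebra X (G v) \<and> p \<inter> \<sigma> v \<noteq> {}}"
  define E where "E = (\<lambda>(v, p). p \<inter> \<sigma> v)"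
  have Greg: "regular_open X g" if "g \<in> G v" for g v using that C by (auto simp: G_def)
  have areg: "regular_open X p" if "p \<in> reg_algebra X (G v)" for p v
    using reg_algebra_regular Greg that by blast
  have \<sigma>reg: "regular_open X (\<sigma> v)" if "regular_open X v" for v
    using \<sigma> that by (auto simp: regular_open_exterior_of regular_open_openin)
  have ES: "regular_open X (E s) \<and> E s \<noteq> {}" if "s \<in> S" for s
  proof -
    obtain v p where s: "s = (v, p)" by fastforce
    then have "regular_open X p" "regular_open X (\<sigma> v)" "p \<inter> \<sigma> v \<noteq> {}"
      using that areg \<sigma>reg by (auto simp: S_def)
    then show ?thesis using regular_open_Int s by (simp add: E_def)
  qed
  obtain C' where C': "countable C'" "\<forall>c\<in>C'. regular_open X c"
    and C'2: "\<And>s. s \<in> S \<Longrightarrow> \<exists>c\<in>C'. \<exists>a. finite a \<and> a \<subseteq> {t\<in>S. (t, s) \<in> L <*lex*> L} \<and>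
             c \<inter> (\<Inter>t\<in>a. X exterior_of (E t)) \<noteq> {} \<and>
             c \<inter> (\<Inter>t\<in>a. X exterior_of (E t)) \<subseteq> E s"
    using R[unfolded countably_refinable_def, rule_format, of "L <*lex*> L" S E]
      L ES by (auto simp: wf_lex_prod trans_lex_prod total_lex_prod)
  have "\<exists>c\<in>C'. \<exists>r\<in>reg_algebra X (G v). c \<inter> r \<noteq> {} \<and> c \<inter> r \<subseteq> p \<inter> \<sigma> v"
    if v: "regular_open X v" and p: "p \<in> reg_algebra X (G v)" and ne: "p \<inter> \<sigma> v \<noteq> {}" for v p
  proof -
    have "(v, p) \<in> S" using that by (simp add: S_def)
    from C'2[OF this] obtain c a where c: "c \<in> C'" and a: "finite a" 
      "a \<subseteq> {t\<in>S. (t, (v,p)) \<in> L <*lex*> L}" and ne: "c \<inter> (\<Inter>t\<in>a. X exterior_of (E t)) \<noteq> {}"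
      and sub: "c \<inter> (\<Inter>t\<in>a. X exterior_of (E t)) \<subseteq> p \<inter> \<sigma> v" unfolding E_def by auto
    define O1 where "O1 = c \<inter> (\<Inter>t\<in>a. X exterior_of (E t))"
    \<comment> \<open>The sets \<open>E t\<close> with first component \<open>v\<close> involve \<open>v\<close> itself, which is not among the generators in
      \<open>G v\<close>. Since everything happens inside \<open>\<sigma> v\<close>, the exterior of \<open>snd t \<inter> \<sigma> v\<close> may be replaced by
      the exterior of \<open>snd t\<close>.\<close>
    define h where "h t = (if fst t = v then X exterior_of (snd t) else X exterior_of (E t))" for t
    define r where "r = topspace X \<inter> (\<Inter>t\<in>a. h t)"
    have cop: "openin X c" using c C' regular_open_openin by blast
    have hin: "h t \<in> reg_algebra X (G v)" if "t \<in> a" for t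
    proof (cases "fst t = v")
      case True
      then show ?thesis using that a unfolding h_def S_def 
        by (auto intro!: reg_algebra.ext)
    next
      case False
      obtain u q where t: "t = (u, q)" by fastforce
      then have u: "(u, v) \<in> L" "regular_open X u" "q \<in> reg_algebra X (G u)" 
        using False that a by (auto simp: S_def)
      have "G u \<subseteq> G v" using u(1) L(2) by (auto simp: G_def dest: transD)
      then have "q \<in> reg_algebra X (G v)" using u(3) reg_algebra_mono by blast
      moreover have "u \<in> reg_algebra X (G v)" 
        using u by (intro reg_algebra.gen) (auto simp: G_def)
      moreover have "\<sigma> u \<in> reg_algebra X (G v)" 
        using \<sigma> \<open>u \<in> reg_algebra X (G v)\<close> by (auto intro: reg_algebra.intros)
      ultimately show ?thesis using False t unfolding h_def E_def 
        by (auto intro: reg_algebra.intros)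
    qed
    have r: "r \<in> reg_algebra X (G v)" unfolding r_def
      by (rule reg_algebra_finite_Inter[OF a(1) hin])
    have tS: "t \<in> S" if "t \<in> a" for t using that a by auto
    have Eop: "openin X (E t)" if "t \<in> a" for t using ES tS that regular_open_openin by blast
    have O1w: "O1 \<subseteq> \<sigma> v" using sub by (auto simp: O1_def)
    have O1op: "openin X O1" 
    proof (cases "a = {}")
      case False
      have "openin X (\<Inter>t\<in>a. X exterior_of (E t))"
        using a False by (intro openin_Inter) auto
      then show ?thesis using cop by (simp add: O1_def openin_Int)
    qed (use cop in \<open>simp add: O1_def\<close>)
    have "c \<inter> r = O1"
    proof (rule subset_antisym)
      have "h t \<subseteq> X exterior_of (E t)" if "t \<in> a" for t
        using exterior_of_mono[of "E t" "snd t" X] by (auto simp: E_def h_def split: prod.splits)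
      then show "c \<inter> r \<subseteq> O1" unfolding r_def O1_def by blast
      have "O1 \<subseteq> h t" if t: "t \<in> a" for t
      proof (cases "fst t = v")
        case True
        \<comment> \<open>Inside \<open>\<sigma> v\<close>, being disjoint from \<open>snd t \<inter> \<sigma> v\<close> means being disjoint from \<open>snd t\<close>.\<close>
        have "O1 \<inter> snd t \<subseteq> O1 \<inter> E t" using O1w True by (auto simp: E_def split: prod.splits)
        also have "\<dots> \<subseteq> X exterior_of (E t) \<inter> E t" using t by (auto simp: O1_def)
        also have "\<dots> = {}" using exterior_of_disjoint[OF openin_subset[OF Eop[OF t]]] by auto
        finally show ?thesis using True exterior_of_maximal[OF O1op] by (simp add: h_def)
      next
        case False
        then show ?thesis using t by (auto simp: h_def O1_def)
      qed
      moreover have "O1 \<subseteq> topspace X" using O1op openin_subset by blast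
      moreover have "O1 \<subseteq> c" by (auto simp: O1_def)
      ultimately show "O1 \<subseteq> c \<inter> r" unfolding r_def by blast
    qed
    then have "c \<inter> r \<noteq> {}" "c \<inter> r \<subseteq> p \<inter> \<sigma> v" using ne sub unfolding O1_def by metis+
    then show ?thesis using c r by blast
  qed
  then show ?thesis using C' by blast
qed

lemma finite_total_maximum:
  assumes "trans L" "total L" "finite A" "A \<noteq> {}"
  obtains m where "m \<in> A" "\<forall>u\<in>A. u = m \<or> (u, m) \<in> L"
proof -
  have "\<exists>m\<in>A. \<forall>u\<in>A. u = m \<or> (u, m) \<in> L"
    using assms(3,4)
  proof (induction rule: finite_ne_induct)
    case (insert u A)
    from insert.IH obtain m where m: "m \<in> A" "\<forall>u\<in>A. u = m \<or> (u, m) \<in> L" by (elim bexE)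
    show ?case
    proof (cases "(m, u) \<in> L")
      case True
      have "(w, u) \<in> L" if "w \<in> A" for w
        using m(2) that True transD[OF assms(1), of w m u] by (cases "w = m") auto
      then show ?thesis by (intro bexI[of _ u]) auto
    next
      case False
      then have "u = m \<or> (u, m) \<in> L" using assms(2) by (auto simp: total_on_def)
      then show ?thesis using m(1) by (intro bexI[of _ m]) (use m(2) in auto)
    qed
  qed simp
  then show ?thesis using that by (elim bexE)
qed

text \<open>
  Iterating \<open>refine_step\<close> gives a countable \<open>Cw\<close> such that a nonempty set generated from \<open>Cw\<close> and finitely many
  regular open sets, the largest of which is \<open>v\<close>, contains a nonempty one whose generators outside \<open>Cw\<close>
  are all smaller than \<open>v\<close>. By well-foundedness it contains a nonempty element of the countable algebra
  generated by \<open>Cw\<close>.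
\<close>
lemma countable_refinement_of_regular_opens:
  fixes X :: "'a topology"
  assumes R: "countably_refinable X TYPE('a set \<times> 'a set)"
  shows "\<exists>C. countable C \<and> (\<forall>c\<in>C. openin X c \<and> c \<noteq> {}) \<and> 
     (\<forall>U. regular_open X U \<longrightarrow> U \<noteq> {} \<longrightarrow> (\<exists>c\<in>C. c \<subseteq> U))"
proof -
  obtain W :: "'a set rel" where W: "well_order_on UNIV W" using well_order_on by blast
  define L where "L = W - Id"
  have L: "wf L" "trans L" "total L"
    using W unfolding L_def well_order_on_def linear_order_on_def partial_order_on_def preorder_on_def
    by (auto simp: trans_diff_Id)
  define below where "below v = {u. regular_open X u \<and> (u, v) \<in> L}" for v
  define good where "good \<sigma> C C' \<longleftrightarrow> countable C' \<and> (\<forall>c\<in>C'. regular_open X c) \<and>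
     (\<forall>v p. regular_open X v \<longrightarrow> p \<in> reg_algebra X (below v \<union> C) \<longrightarrow> p \<inter> \<sigma> v \<noteq> {} \<longrightarrow>
       (\<exists>c\<in>C'. \<exists>r\<in>reg_algebra X (below v \<union> C). c \<inter> r \<noteq> {} \<and> c \<inter> r \<subseteq> p \<inter> \<sigma> v))" for \<sigma> C C'
  have ex: "\<exists>C'. good \<sigma> C C'" if "\<forall>c\<in>C. regular_open X c" 
      "(\<forall>v. \<sigma> v = v) \<or> (\<forall>v. \<sigma> v = X exterior_of v)" for C \<sigma>
    unfolding good_def below_def using refine_step[OF R L, of C \<sigma>] that by blast
  define nxt where "nxt \<sigma> C = (SOME C'. good \<sigma> C C')" for \<sigma> C
  have nxt: "good \<sigma> C (nxt \<sigma> C)" if "\<forall>c\<in>C. regular_open X c" 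
      "(\<forall>v. \<sigma> v = v) \<or> (\<forall>v. \<sigma> v = X exterior_of v)" for C \<sigma>
    unfolding nxt_def using someI_ex[OF ex[OF that]] .
  define step where "step C = C \<union> nxt id C \<union> nxt ((exterior_of) X) C" for C
  \<comment> \<open>The set supplied by \<open>refine_step\<close> depends on the generators allowed so far, hence the \<open>\<omega>\<close> rounds. An
    element uses finitely many generators, so it already appears at a finite stage.\<close>
  define Cs where "Cs n = (step ^^ n) {}" for n
  have Cs0: "Cs 0 = {}" and CsS: "Cs (Suc n) = step (Cs n)" for n by (auto simp: Cs_def)
  have Cs: "countable (Cs n) \<and> (\<forall>c\<in>Cs n. regular_open X c)" for n
  proof (induction n)
    case (Suc n)
    have "good id (Cs n) (nxt id (Cs n))" "good ((exterior_of) X) (Cs n) (nxt ((exterior_of) X) (Cs n))"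
      using Suc by (auto intro!: nxt)
    then show ?case using Suc by (auto simp: CsS step_def good_def)
  qed (simp add: Cs0)
  define Cw where "Cw = (\<Union>n. Cs n)"
  have mono: "mono Cs" by (rule incseq_SucI) (auto simp: CsS step_def)
  have Cw: "countable Cw" "\<forall>c\<in>Cw. regular_open X c" using Cs by (auto simp: Cw_def)
  have supp: "\<exists>n. p \<in> reg_algebra X (A \<union> Cs n)" if "p \<in> reg_algebra X (A \<union> Cw)" for p A
    using that
  proof induction
    case (Int x y)
    then obtain m n where "x \<in> reg_algebra X (A \<union> Cs m)" "y \<in> reg_algebra X (A \<union> Cs n)" by blast
    then have "x \<in> reg_algebra X (A \<union> Cs (max m n))" "y \<in> reg_algebra X (A \<union> Cs (max m n))"
      using monoD[OF mono, of m "max m n"] monoD[OF mono, of n "max m n"]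
         reg_algebra_mono[of "A \<union> Cs m" "A \<union> Cs (max m n)" X] 
         reg_algebra_mono[of "A \<union> Cs n" "A \<union> Cs (max m n)" X] by auto
    then show ?case by (blast intro: reg_algebra.Int)
  next
    case (gen g)
    then have "\<exists>n. g \<in> A \<union> Cs n" by (auto simp: Cw_def)
    then show ?case by (blast intro: reg_algebra.gen)
  qed (blast intro: reg_algebra.top reg_algebra.ext)+
  \<comment> \<open>Induction on the largest generator that is not in \<open>Cw\<close>.\<close>
  have main: "\<forall>x \<in> reg_algebra X (insert v (below v) \<union> Cw). regular_open X v \<longrightarrow> x \<noteq> {} \<longrightarrow> 
     (\<exists>y\<in>reg_algebra X Cw. y \<noteq> {} \<and> y \<subseteq> x)" for v
    using L(1)
  proof (induction v)
    case (less v)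
    show ?case
    proof (intro ballI impI)
      fix x assume x: "x \<in> reg_algebra X (insert v (below v) \<union> Cw)" "regular_open X v" "x \<noteq> {}"
      have Greg: "regular_open X g" if "g \<in> below v \<union> Cw" for g using that Cw by (auto simp: below_def)
      have xop: "openin X x" 
        using reg_algebra_regular[OF _ x(1)] x(2) Greg regular_open_openin by blast
      have "\<exists>\<sigma>. (\<sigma> = id \<or> \<sigma> = (exterior_of) X) \<and> x \<inter> \<sigma> v \<noteq> {}"
      proof (cases "x \<inter> v = {}")
        case True
        then have "x \<subseteq> X exterior_of v" using exterior_of_maximal xop by blast
        then show ?thesis using x(3) by blast
      next
        case False
        then have "x \<inter> id v \<noteq> {}" by simp
        then show ?thesis by blast
      qed
      then obtain \<sigma> where \<sigma>: "\<sigma> = id \<or> \<sigma> = (exterior_of) X" and ne: "x \<inter> \<sigma> v \<noteq> {}" by blast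
      have "x \<in> reg_algebra X (insert v (below v \<union> Cw))" using x(1) by simp
      moreover have "\<sigma> v = v \<or> \<sigma> v = X exterior_of v" using \<sigma> by auto
      ultimately have "\<exists>p\<in>reg_algebra X (below v \<union> Cw). x \<inter> \<sigma> v = p \<inter> \<sigma> v"
        by (intro reg_algebra_insert[OF Greg x(2)])
      then obtain p where p: "p \<in> reg_algebra X (below v \<union> Cw)" "x \<inter> \<sigma> v = p \<inter> \<sigma> v"
        by (elim bexE)
      obtain n where n: "p \<in> reg_algebra X (below v \<union> Cs n)" using supp p(1) by blast
      have g: "good \<sigma> (Cs n) (nxt \<sigma> (Cs n))" using Cs \<sigma> by (intro nxt) auto
      obtain c r where cr: "c \<in> nxt \<sigma> (Cs n)" "r \<in> reg_algebra X (below v \<union> Cs n)" 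
         "c \<inter> r \<noteq> {}" "c \<inter> r \<subseteq> p \<inter> \<sigma> v"
        using g n ne p(2) x(2) unfolding good_def by blast
      have "c \<in> Cs (Suc n)" using cr(1) \<sigma> by (auto simp: CsS step_def)
      then have "c \<in> below v \<union> Cw" by (auto simp: Cw_def)
      then have "c \<in> reg_algebra X (below v \<union> Cw)" by (rule reg_algebra.gen)
      moreover have "r \<in> reg_algebra X (below v \<union> Cw)"
        using cr(2) reg_algebra_mono[of "below v \<union> Cs n" "below v \<union> Cw" X] unfolding Cw_def by blast
      ultimately have "c \<inter> r \<in> reg_algebra X (below v \<union> Cw)" by (rule reg_algebra.Int)
      then obtain F where F: "finite F" "F \<subseteq> below v \<union> Cw" "c \<inter> r \<in> reg_algebra X F"
        using reg_algebra_finite_support by blast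
      have "\<exists>y\<in>reg_algebra X Cw. y \<noteq> {} \<and> y \<subseteq> c \<inter> r"
      proof (cases "F \<inter> below v = {}")
        case True
        then have "F \<subseteq> Cw" using F by blast
        then have "c \<inter> r \<in> reg_algebra X Cw" using F(3) reg_algebra_mono by blast
        then show ?thesis using cr(3) by (intro bexI[of _ "c \<inter> r"]) auto
      next
        case False
        have fin: "finite (F \<inter> below v)" using F by simp
        obtain m where "m \<in> F \<inter> below v" "\<forall>u\<in>F \<inter> below v. u = m \<or> (u, m) \<in> L"
          using finite_total_maximum[OF L(2,3) fin False] by blast
        then obtain m where m: "m \<in> F" "m \<in> below v" "\<forall>u\<in>F \<inter> below v. u = m \<or> (u, m) \<in> L" by blast
        have "F \<subseteq> insert m (below m) \<union> Cw" using F m by (auto simp: below_def)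
        then have "c \<inter> r \<in> reg_algebra X (insert m (below m) \<union> Cw)" using F(3) reg_algebra_mono by blast
        moreover have "(m, v) \<in> L" "regular_open X m" using m by (auto simp: below_def)
        ultimately show ?thesis using less[of m] cr(3) by (simp only: simp_thms ball_simps)
      qed
      then show "\<exists>y\<in>reg_algebra X Cw. y \<noteq> {} \<and> y \<subseteq> x" using cr(4) p(2) by blast
    qed
  qed
  define C where "C = reg_algebra X Cw - {{}}"
  have "countable C" using countable_reg_algebra Cw by (auto simp: C_def)
  moreover have "openin X c \<and> c \<noteq> {}" if "c \<in> C" for c
    using that reg_algebra_regular[of Cw X c] Cw regular_open_openin by (auto simp: C_def)
  moreover have "\<exists>c\<in>C. c \<subseteq> U" if "regular_open X U" "U \<noteq> {}" for U
    using main[of U] that reg_algebra.gen[of U "insert U (below U) \<union> Cw" X] by (auto simp: C_def)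
  ultimately show ?thesis by blast
qed

section \<open>Countable cellularity\<close>

lemma dense_subset_iff:
  "dense_subset X D \<longleftrightarrow> D \<subseteq> topspace X \<and> (\<forall>U. openin X U \<longrightarrow> U \<noteq> {} \<longrightarrow> U \<inter> D \<noteq> {})"
  unfolding dense_subset_def dense_intersects_open by blast

text \<open>The hypothesis of dense \<open>k\<close>-separability without cardinals.\<close>
definition dense_sets_k_separable :: "'a topology \<Rightarrow> bool" where
  "dense_sets_k_separable X \<longleftrightarrow>
     (\<forall>Y. dense_subset X Y \<longrightarrow>
        (\<exists>\<K>. countable \<K> \<and> (\<forall>K\<in>\<K>. compactin X K \<and> K \<subseteq> Y) \<and> dense_subset X (\<Union>\<K>)))"

definition countable_cellularity :: "'a topology \<Rightarrow> bool" where
  "countable_cellularity X \<longleftrightarrow>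
     (\<forall>\<U>. disjoint \<U> \<longrightarrow> (\<forall>U\<in>\<U>. openin X U \<and> U \<noteq> {}) \<longrightarrow> countable \<U>)"

lemma maximal_disjoint_subfamily:
  obtains \<U> where "\<U> \<subseteq> \<P>" "disjoint \<U>" "\<And>P. P \<in> \<P> \<Longrightarrow> P \<noteq> {} \<Longrightarrow> \<exists>U\<in>\<U>. P \<inter> U \<noteq> {}"
proof -
  define F where "F = {\<U>. \<U> \<subseteq> \<P> \<and> disjoint \<U>}"
  have "\<Union>C \<in> F" if "subset.chain F C" for C
  proof -
    have "C \<subseteq> F" "\<And>A B. A \<in> C \<Longrightarrow> B \<in> C \<Longrightarrow> A \<subseteq> B \<or> B \<subseteq> A"
      using that by (auto simp: subset_chain_def)
    moreover have "disjoint (\<Union>C)"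
      unfolding disjoint_def
    proof (intro ballI impI)
      fix a b assume "a \<in> \<Union>C" "b \<in> \<Union>C" "a \<noteq> b"
      then obtain A B where AB: "A \<in> C" "B \<in> C" "a \<in> A" "b \<in> B" by blast
      then obtain D where D: "D \<in> C" "a \<in> D" "b \<in> D" using calculation(2)[of A B] by blast
      then have "disjoint D" using calculation(1) by (auto simp: F_def)
      then show "a \<inter> b = {}" using D \<open>a \<noteq> b\<close> by (simp add: disjoint_def)
    qed
    ultimately show ?thesis by (auto simp: F_def)
  qed
  from subset_Zorn'[OF this] obtain \<U> where \<U>: "\<U> \<in> F" "\<forall>\<V>\<in>F. \<U> \<subseteq> \<V> \<longrightarrow> \<V> = \<U>" by blast
  have "\<exists>U\<in>\<U>. P \<inter> U \<noteq> {}" if P: "P \<in> \<P>" "P \<noteq> {}" for P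
  proof (rule ccontr)
    assume c: "\<not> ?thesis"
    then have "insert P \<U> \<in> F" using \<U>(1) P unfolding F_def disjoint_def by auto
    then have "P \<in> \<U>" using \<U>(2) by blast
    then show False using c P(2) by blast
  qed
  then show ?thesis using that \<U>(1) by (auto simp: F_def)
qed

lemma dense_subset_Un_exterior:
  assumes "openin X U" shows "dense_subset X (U \<union> X exterior_of U)"
  unfolding dense_subset_iff
proof (intro conjI allI impI)
  show "U \<union> X exterior_of U \<subseteq> topspace X"
    using openin_subset[OF assms] exterior_of_subset_topspace[of X U] by blast
  fix V assume "openin X V" "V \<noteq> {}"
  then show "V \<inter> (U \<union> X exterior_of U) \<noteq> {}" using exterior_of_maximal[of X V U] by blast
qed

text \<open>
  A compact set covered by a disjoint family of open sets meets only finitely many of them, while countably many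
  compact sets with dense union together meet all of them.
\<close>
lemma k_separable_imp_countable_cellularity:
  assumes "dense_sets_k_separable X"
  shows "countable_cellularity X"
  unfolding countable_cellularity_def
proof (intro allI impI)
  fix \<U> assume dis: "disjoint \<U>" and op: "\<forall>U\<in>\<U>. openin X U \<and> U \<noteq> {}"
  \<comment> \<open>Adding the exterior turns the union of \<open>\<U>\<close> into a dense set.\<close>
  define E where "E = X exterior_of (\<Union>\<U>)"
  have "openin X (\<Union>\<U>)" using op by blast
  then obtain \<K> where \<K>: "countable \<K>" "\<And>K. K \<in> \<K> \<Longrightarrow> compactin X K \<and> K \<subseteq> \<Union>\<U> \<union> E"
     "dense_subset X (\<Union>\<K>)"
    using assms dense_subset_Un_exterior unfolding dense_sets_k_separable_def E_def by metis
  have "finite {U\<in>\<U>. U \<inter> K \<noteq> {}}" if K: "K \<in> \<K>" for K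
  proof -
    have "compactin X K" "K \<subseteq> \<Union>(insert E \<U>)" using \<K>(2)[OF K] by auto
    moreover have "\<forall>U\<in>insert E \<U>. openin X U" using op by (simp add: E_def)
    ultimately obtain \<F> where F: "finite \<F>" "\<F> \<subseteq> insert E \<U>" "K \<subseteq> \<Union>\<F>" 
      by (meson compactinD)
    have "{U\<in>\<U>. U \<inter> K \<noteq> {}} \<subseteq> \<F>"
    proof
      fix U assume "U \<in> {U\<in>\<U>. U \<inter> K \<noteq> {}}"
      then obtain x where x: "U \<in> \<U>" "x \<in> U" "x \<in> K" by blast
      then obtain V where V: "V \<in> \<F>" "x \<in> V" using F by blast
      have "\<Union>\<U> \<inter> E = {}" unfolding E_def
        using op openin_subset by (intro exterior_of_disjoint) blast
      then have "V \<in> \<U>" using x V F(2) by blast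
      then have "V = U" using dis x V unfolding disjoint_def by blast
      then show "U \<in> \<F>" using V by simp
    qed
    then show ?thesis using F(1) finite_subset by blast
  qed
  then have "countable (\<Union>K\<in>\<K>. {U\<in>\<U>. U \<inter> K \<noteq> {}})"
    using \<K>(1) by (meson countable_UN countable_finite)
  moreover have "\<U> \<subseteq> (\<Union>K\<in>\<K>. {U\<in>\<U>. U \<inter> K \<noteq> {}})"
  proof
    fix U assume U: "U \<in> \<U>"
    then have "U \<inter> \<Union>\<K> \<noteq> {}" using op \<K>(3) by (simp add: dense_subset_iff)
    then obtain K where "K \<in> \<K>" "U \<inter> K \<noteq> {}" by auto
    then show "U \<in> (\<Union>K\<in>\<K>. {U\<in>\<U>. U \<inter> K \<noteq> {}})" using U by auto
  qed
  ultimately show "countable \<U>" using countable_subset by blast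
qed

section \<open>Continuum many points and injective choices\<close>

text \<open>
  Transfinite recursion along a well-order of \<open>I\<close> of minimal type: fewer than continuum many points are used
  up before each stage, so \<open>g i\<close> still contains an unused one.
\<close>
lemma injective_choice_continuum:
  fixes g :: "'i \<Rightarrow> 'b set"
  assumes I: "I \<lesssim> (UNIV :: real set)" and g: "\<And>i. i \<in> I \<Longrightarrow> (UNIV :: real set) \<lesssim> g i"
  shows "\<exists>h. inj_on h I \<and> (\<forall>i\<in>I. h i \<in> g i)"
proof -
  define r where "r = card_of I"
  have r: "Card_order r" "well_order_on I r" "Field r = I"
    by (simp_all add: r_def card_of_card_order_on card_of_well_order_on Field_card_of)
  have wf: "wf (r - Id)" using r(2) by (simp add: well_order_on_def)
  define F where "F f i = (SOME b. b \<in> g i \<and> b \<notin> f ` underS r i)" for f :: "'i \<Rightarrow> 'b" and i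
  define h where "h = wfrec (r - Id) F"
  have h: "h i = F h i" for i
  proof -
    have "h i = F (cut h (r - Id) i) i" unfolding h_def by (rule wfrec[OF wf])
    also have "\<dots> = F h i"
    proof -
      have "cut h (r - Id) i ` underS r i = h ` underS r i"
        by (rule image_cong) (auto simp: underS_def cut_apply)
      then show ?thesis by (simp add: F_def)
    qed
    finally show ?thesis .
  qed
  have hi: "h i \<in> g i \<and> h i \<notin> h ` underS r i" if i: "i \<in> I" for i
  proof -
    have "\<exists>b. b \<in> g i \<and> b \<notin> h ` underS r i"
    proof (rule ccontr)
      assume "\<not> ?thesis"
      then have "g i \<subseteq> h ` underS r i" by blast
      then have "|g i| \<le>o |underS r i|" by (rule surj_imp_ordLeq)
      moreover have "|underS r i| <o r" using r(1,3) i by (intro card_of_underS) auto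
      moreover have "r \<le>o |g i|"
        using lepoll_trans[OF I g[OF i]] unfolding r_def lepoll_def card_of_ordLeq .
      ultimately show False using not_ordLess_ordLeq ordLeq_ordLess_trans by blast
    qed
    then have "F h i \<in> g i \<and> F h i \<notin> h ` underS r i" unfolding F_def by (rule someI_ex)
    then show ?thesis using h by simp
  qed
  have "inj_on h I"
  proof (rule inj_onI)
    fix i j assume ij: "i \<in> I" "j \<in> I" "h i = h j"
    have "total_on I r" using r(2) by (simp add: well_order_on_def linear_order_on_def)
    then have "i = j \<or> (i, j) \<in> r \<or> (j, i) \<in> r" using ij by (auto simp: total_on_def)
    moreover have "i \<notin> underS r j" "j \<notin> underS r i"
      using hi[OF ij(1)] hi[OF ij(2)] ij(3) by (metis imageI)+
    ultimately show "i = j" by (auto simp: underS_def)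
  qed
  then show ?thesis using hi by blast
qed

lemma crowded_compact_continuum:
  assumes "compact_space X" "Hausdorff_space X" "topspace X \<noteq> {}"
    and "\<And>x. x \<in> topspace X \<Longrightarrow> \<not> openin X {x}"
  shows "(UNIV :: real set) \<lesssim> topspace X"
proof (rule lepoll_perfect_set)
  show "completely_metrizable_space X \<or> locally_compact_space X \<and> Hausdorff_space X"
    using assms compact_imp_locally_compact_space by blast
  show "X derived_set_of topspace X = topspace X"
    using assms(4) by (auto simp: derived_set_of_topspace)
qed fact

text \<open>
  The map restricts to a homeomorphism from \<open>K\<close> onto a compact metric space; the points of \<open>K\<close> over a
  countable dense subset of the image are dense in \<open>K\<close>.
\<close>
lemma compactin_separable_by_injection:
  fixes f :: "'a \<Rightarrow> 'm::{metric_space,second_countable_topology}"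
  assumes K: "compactin X K" and f: "continuous_map X euclidean f" and inj: "inj_on f K"
  obtains D where "countable D" "D \<subseteq> K" "K \<subseteq> X closure_of D"
proof -
  obtain Q where Q: "countable Q" "Q \<subseteq> f ` K" "f ` K \<subseteq> closure Q"
    using separable by blast
  define D where "D = {x \<in> K. f x \<in> Q}"
  have fD: "f ` D = Q" using Q(2) by (auto simp: D_def)
  have "inj_on f D" using inj by (rule inj_on_subset) (auto simp: D_def)
  then have "countable D" using Q(1) fD countable_image_inj_on by blast
  moreover have "K \<subseteq> X closure_of D"
  proof -
    have "compactin X (K \<inter> X closure_of D)"
      using K by (intro compact_Int_closedin) auto
    then have "compact (f ` (K \<inter> X closure_of D))"
      using image_compactin[OF _ f] by simp
    then have cl: "closed (f ` (K \<inter> X closure_of D))" by (rule compact_imp_closed)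
    have "D \<subseteq> K \<inter> X closure_of D"
      using closure_of_subset[of D X] compactin_subset_topspace[OF K] by (auto simp: D_def)
    then have "Q \<subseteq> f ` (K \<inter> X closure_of D)" using fD by blast
    then have "closure Q \<subseteq> f ` (K \<inter> X closure_of D)" using cl closure_minimal by blast
    then have fK: "f ` K \<subseteq> f ` (K \<inter> X closure_of D)" using Q(3) by blast
    show ?thesis
    proof
      fix x assume x: "x \<in> K"
      then obtain y where "y \<in> K" "y \<in> X closure_of D" "f x = f y" using fK by blast
      then show "x \<in> X closure_of D" using inj x by (auto simp: inj_on_def)
    qed
  qed
  ultimately show ?thesis using that by (auto simp: D_def)
qed

section \<open>Greedy choice of points in the fibres of a map\<close>

lemma greedy_set:
  assumes "wf L"
  shows "\<exists>A\<subseteq>S. \<forall>s\<in>S. s \<in> A \<longleftrightarrow> P {t \<in> A. (t, s) \<in> L} s"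
proof -
  define F where "F f s \<longleftrightarrow> P {t \<in> S. (t, s) \<in> L \<and> f t} s" for f :: "'a \<Rightarrow> bool" and s
  define h where "h = wfrec L F"
  have h: "h s = F h s" for s
  proof -
    have "h s = F (cut h L s) s" unfolding h_def by (rule wfrec[OF assms])
    also have "{t \<in> S. (t, s) \<in> L \<and> cut h L s t} = {t \<in> S. (t, s) \<in> L \<and> h t}"
      by (auto simp: cut_apply)
    then have "F (cut h L s) s = F h s" by (simp add: F_def)
    finally show ?thesis .
  qed
  have "{t \<in> {s \<in> S. h s}. (t, s) \<in> L} = {t \<in> S. (t, s) \<in> L \<and> h t}" for s by blast
  then have "h s \<longleftrightarrow> P {t \<in> {s \<in> S. h s}. (t, s) \<in> L} s" for s using h[of s] by (simp only: F_def)
  then show ?thesis by (intro exI[of _ "{s \<in> S. h s}"]) blast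
qed

lemma open_meets_closure: "openin X U \<Longrightarrow> x \<in> U \<Longrightarrow> x \<in> X closure_of T \<Longrightarrow> U \<inter> T \<noteq> {}"
  by (metis disjoint_iff in_closure_of)

text \<open>
  The indices are run through in increasing order, and \<open>s\<close> is accepted if adding the exterior of \<open>E s\<close> to
  the finitely many exteriors accepted before never makes an approximation \<open>N m a\<close> of the fibre over \<open>r\<close>
  empty. The sets \<open>N m a\<close> with accepted \<open>a\<close> then have the finite intersection property, and a
  point in all their closures lies over \<open>r\<close> and outside all accepted \<open>E s\<close>. So a set \<open>E s\<close> that contains the
  point was rejected, and the rejection has a finite witness \<open>m\<close>, \<open>a\<close>.
\<close>
lemma greedy_point:
  fixes f :: "'a \<Rightarrow> 'm::metric_space"
  assumes X: "compact_space X" and f: "continuous_map X euclidean f"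
    and L: "wf L" "trans L" "total L" and E: "\<And>s. s \<in> S \<Longrightarrow> openin X (E s)"
    and B: "openin X B" and r: "r \<in> f ` (X closure_of B)"
  defines "N \<equiv> \<lambda>m a. {x \<in> B. dist r (f x) < 1 / Suc m} \<inter> (\<Inter>t\<in>a. X exterior_of (E t))"
  shows "\<exists>y. y \<in> X closure_of B \<and> f y = r \<and> (\<forall>s\<in>S. y \<in> E s \<longrightarrow>
      (\<exists>m a. finite a \<and> a \<subseteq> {t\<in>S. (t, s) \<in> L} \<and> N m a \<noteq> {} \<and> N m a \<inter> X exterior_of (E s) = {}))"
proof -
  define P where "P T s \<longleftrightarrow> (\<forall>m a. finite a \<and> a \<subseteq> T \<longrightarrow> N m a \<inter> X exterior_of (E s) \<noteq> {})" for T s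
  obtain A where A: "A \<subseteq> S" and As: "\<And>s. s \<in> S \<Longrightarrow> s \<in> A \<longleftrightarrow> P {t \<in> A. (t, s) \<in> L} s"
    using greedy_set[OF L(1), of S P] by auto
  have BX: "B \<subseteq> topspace X" using openin_subset[OF B] .
  have ball: "openin X {x \<in> topspace X. f x \<in> ball r e}" for e
    using f by (auto simp: continuous_map_def)
  have ne: "N m a \<noteq> {}" if a: "finite a" "a \<subseteq> A" for m a
  proof (cases "a = {}")
    case True
    \<comment> \<open>The value \<open>r\<close> is attained on the closure of \<open>B\<close>, so it is approximated on \<open>B\<close>.\<close>
    obtain x where x: "x \<in> X closure_of B" "f x = r" using r by blast
    have "x \<in> {x \<in> topspace X. f x \<in> ball r (1 / Suc m)}"
      using x by (auto simp: in_closure_of)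
    then have "{x \<in> topspace X. f x \<in> ball r (1 / Suc m)} \<inter> B \<noteq> {}"
      using open_meets_closure[OF ball _ x(1)] by blast
    then show ?thesis using True by (auto simp: N_def)
  next
    case False
    \<comment> \<open>When the largest index \<open>s\<close> was accepted, the others had been accepted already.\<close>
    obtain s where s: "s \<in> a" "\<forall>t\<in>a. t = s \<or> (t, s) \<in> L"
      using finite_total_maximum[OF L(2,3) a(1) False] by blast
    have "N m (a - {s}) \<inter> X exterior_of (E s) \<noteq> {}"
    proof -
      have "s \<in> A" "finite (a - {s})" "a - {s} \<subseteq> {t \<in> A. (t, s) \<in> L}" using s a by auto
      then show ?thesis using As[of s] A unfolding P_def by blast
    qed
    moreover have "N m (a - {s}) \<inter> X exterior_of (E s) \<subseteq> N m a"
      using s(1) by (auto simp: N_def)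
    ultimately show ?thesis by blast
  qed
  have NX: "N m a \<subseteq> topspace X" for m a using BX by (auto simp: N_def)
  define \<F> where "\<F> = (\<lambda>(m, a). X closure_of (N m a)) ` {(m, a). finite a \<and> a \<subseteq> A}"
  have fip: "\<Inter>\<G> \<noteq> {}" if G: "finite \<G> \<and> \<G> \<subseteq> \<F>" for \<G>
  proof -
    from G obtain P where P: "finite P" "P \<subseteq> {(m, a). finite a \<and> a \<subseteq> A}" 
      "\<G> = (\<lambda>(m, a). X closure_of (N m a)) ` P"
      unfolding \<F>_def by (meson finite_subset_image)
    define M where "M = Max (insert 0 (fst ` P))"
    define a where "a = \<Union>(snd ` P)"
    have a: "finite a" "a \<subseteq> A" using P(1,2) unfolding a_def by (fastforce simp: subset_iff)+
    obtain x where x: "x \<in> N M a" using ne[OF a] by blast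
    have "x \<in> X closure_of (N m b)" if mb: "(m, b) \<in> P" for m b
    proof -
      have "m \<le> M" using mb P(1) by (auto simp: M_def intro!: Max_ge image_eqI)
      then have "(1::real) / Suc M \<le> 1 / Suc m" by (simp add: frac_le)
      moreover have "b \<subseteq> a" using mb by (force simp: a_def)
      ultimately have "x \<in> N m b" using x by (force simp: N_def)
      then show ?thesis using closure_of_subset[OF NX] by blast
    qed
    then have "x \<in> \<Inter>\<G>" unfolding P(3) by auto
    then show ?thesis by blast
  qed
  have "\<forall>C\<in>\<F>. closedin X C" by (auto simp: \<F>_def)
  then have "\<Inter>\<F> \<noteq> {}" using X fip unfolding compact_space_fip by metis
  then obtain y where y: "\<And>m a. finite a \<Longrightarrow> a \<subseteq> A \<Longrightarrow> y \<in> X closure_of (N m a)"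
    unfolding \<F>_def by fast
  have yX: "y \<in> topspace X" using y[of "{}"] by (auto simp: in_closure_of)
  have "y \<in> X closure_of B" using y[of "{}" 0] closure_of_mono[of "N 0 {}" B X] by (auto simp: N_def)
  moreover have "f y = r"
  proof (rule ccontr)
    assume "f y \<noteq> r"
    then have d: "dist r (f y) > 0" by simp
    then obtain m where m: "1 / Suc m < dist r (f y)" using nat_approx_posE by blast
    define V where "V = {x \<in> topspace X. f x \<in> - cball r (1 / Suc m)}"
    have "openin X V" using f unfolding V_def continuous_map_def by (auto simp: open_Compl)
    moreover have "y \<in> V" using m yX by (auto simp: V_def)
    moreover have "y \<in> X closure_of (N m {})" by (intro y) auto
    ultimately have "V \<inter> N m {} \<noteq> {}" by (rule open_meets_closure)
    then show False by (auto simp: V_def N_def)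
  qed
  moreover have "\<exists>m a. finite a \<and> a \<subseteq> {t\<in>S. (t, s) \<in> L} \<and> 
        N m a \<noteq> {} \<and> N m a \<inter> X exterior_of (E s) = {}" if s: "s \<in> S" "y \<in> E s" for s
  proof -
    have "s \<notin> A"
    proof
      assume "s \<in> A"
      then have "y \<in> X closure_of (N 0 {s})" using y by simp
      then have "E s \<inter> N 0 {s} \<noteq> {}" by (rule open_meets_closure[OF E[OF s(1)] s(2)])
      then show False using exterior_of_disjoint[OF openin_subset[OF E[OF s(1)]]] by (auto simp: N_def)
    qed
    then obtain m a where ma: "finite a" "a \<subseteq> {t \<in> A. (t, s) \<in> L}" "N m a \<inter> X exterior_of (E s) = {}"
      using As[OF s(1)] unfolding P_def by blast
    moreover from ma(1,2) have "N m a \<noteq> {}" by (intro ne) auto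
    moreover from ma(2) A have "a \<subseteq> {t \<in> S. (t, s) \<in> L}" by blast
    ultimately show ?thesis by blast
  qed
  ultimately show ?thesis by (intro exI[of _ y]) blast
qed

lemma compact_Hausdorff_open_shrink:
  assumes "compact_space X" "Hausdorff_space X" "openin X U" "x \<in> U"
  obtains V where "openin X V" "x \<in> V" "X closure_of V \<subseteq> U"
proof -
  have "neighbourhood_base_of (closedin X) X"
    using assms compact_Hausdorff_imp_regular_space neighbourhood_base_of_closedin by blast
  then have "\<exists>V C. openin X V \<and> closedin X C \<and> x \<in> V \<and> V \<subseteq> C \<and> C \<subseteq> U"
    using assms(3,4) unfolding neighbourhood_base_of by simp
  then obtain V C where V: "openin X V" "closedin X C" "x \<in> V" "V \<subseteq> C" "C \<subseteq> U"
    by (elim exE conjE)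
  then have "X closure_of V \<subseteq> U" using closure_of_minimal[of V C X] by simp
  then show ?thesis using that V by simp
qed

definition no_isolated_points_in :: "'a topology \<Rightarrow> 'a set \<Rightarrow> bool" where
  "no_isolated_points_in X U \<longleftrightarrow> (\<forall>x\<in>U. \<not> openin X {x})"

text \<open>
  If \<open>f\<close> takes infinitely many values on every nonempty open subset of \<open>V\<close>, no value is isolated in the image of
  the closure; this image is therefore compact and perfect.
\<close>
lemma image_closure_continuum:
  assumes X: "compact_space X" and Z: "Hausdorff_space Z" and f: "continuous_map X Z f"
    and V: "openin X V" "V \<noteq> {}"
    and rich: "\<And>U. openin X U \<Longrightarrow> U \<noteq> {} \<Longrightarrow> U \<subseteq> V \<Longrightarrow> infinite (f ` U)"
  shows "(UNIV :: real set) \<lesssim> f ` (X closure_of V)"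
proof -
  define S where "S = f ` (X closure_of V)"
  have "compactin X (X closure_of V)" using X by (simp add: closedin_compact_space)
  then have S: "compactin Z S" unfolding S_def using image_compactin[OF _ f] by simp
  then have 1: "compact_space (subtopology Z S)" by (rule compact_space_subtopology)
  have 2: "Hausdorff_space (subtopology Z S)" using Z by (rule Hausdorff_space_subtopology)
  have top: "topspace (subtopology Z S) = S"
    using compactin_subset_topspace[OF S] by auto
  have "V \<subseteq> X closure_of V" by (rule closure_of_subset[OF openin_subset[OF V(1)]])
  then have 3: "topspace (subtopology Z S) \<noteq> {}" using V(2) unfolding top by (auto simp: S_def)
  have 4: "\<not> openin (subtopology Z S) {y}" if "y \<in> topspace (subtopology Z S)" for y
  proof
    assume "openin (subtopology Z S) {y}"
    then obtain W where W: "openin Z W" "{y} = W \<inter> S" by (auto simp: openin_subtopology)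
    have "y \<in> S" using that by simp
    then obtain x where x: "x \<in> X closure_of V" "f x = y" by (auto simp: S_def)
    define U where "U = {x \<in> topspace X. f x \<in> W}"
    have U: "openin X U" using f W(1) by (auto simp: U_def continuous_map_def)
    have "x \<in> U" using x W(2) by (auto simp: U_def in_closure_of)
    then have "U \<inter> V \<noteq> {}" using open_meets_closure U x(1) by metis
    then have "infinite (f ` (U \<inter> V))" using rich[of "U \<inter> V"] U V(1) by auto
    moreover have "f ` (U \<inter> V) \<subseteq> {y}"
      unfolding W(2) using \<open>V \<subseteq> X closure_of V\<close> by (auto simp: S_def U_def)
    ultimately show False using finite_subset by blast
  qed
  show ?thesis using crowded_compact_continuum[OF 1 2 3 4] unfolding top by (simp add: S_def)
qed

section \<open>Refining well-ordered families by means of a rich map\<close>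

text \<open>
  The compact sets \<open>f ` (X closure_of V B)\<close>, with \<open>V B\<close> shrunk inside \<open>B\<close>, have continuum many points, so distinct
  values \<open>h B\<close> can be chosen in them; \<open>greedy_point\<close> then gives points \<open>y B \<in> B\<close> over \<open>h B\<close>. On the dense set
  of isolated points and points \<open>y B\<close> the map \<open>f\<close> is injective, so the hypothesis yields a
  countable dense subset \<open>D\<close> of it. Every \<open>E s\<close> contains a point of \<open>D\<close>, and if this point is \<open>y B\<close>, its
  failure to avoid \<open>E s\<close> provides the refinement.
\<close>
lemma k_separable_countably_refinable:
  fixes f :: "'a \<Rightarrow> 'm::{metric_space,second_countable_topology}"
  assumes X: "compact_space X" "Hausdorff_space X" and K: "dense_sets_k_separable X"
    and \<B>: "pi_base X \<B>" "\<B> \<lesssim> (UNIV :: real set)"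
    and f: "continuous_map X euclidean f"
    and iso: "\<And>i x. openin X {i} \<Longrightarrow> x \<in> topspace X \<Longrightarrow> f x = f i \<Longrightarrow> x = i"
    and rich: "\<And>U. openin X U \<Longrightarrow> U \<noteq> {} \<Longrightarrow> no_isolated_points_in X U \<Longrightarrow> infinite (f ` U)"
  shows "countably_refinable X TYPE('b)"
  unfolding countably_refinable_def
proof (intro allI impI)
  fix S :: "'b set" and L :: "'b rel" and E :: "'b \<Rightarrow> 'a set"
  assume L: "wf L" "trans L" "total L" and E: "\<forall>s\<in>S. regular_open X (E s) \<and> E s \<noteq> {}"
  define I where "I = {x. openin X {x}}"
  define \<B>' where "\<B>' = {B \<in> \<B>. B \<inter> I = {}}"
  have \<B>': "openin X B \<and> B \<noteq> {}" if "B \<in> \<B>'" for B using that \<B>(1) by (auto simp: \<B>'_def pi_base_def)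
  have "\<forall>B\<in>\<B>'. \<exists>V. openin X V \<and> V \<noteq> {} \<and> X closure_of V \<subseteq> B"
  proof
    fix B assume "B \<in> \<B>'"
    then obtain x where "x \<in> B" "openin X B" using \<B>' by blast
    then show "\<exists>V. openin X V \<and> V \<noteq> {} \<and> X closure_of V \<subseteq> B"
      using compact_Hausdorff_open_shrink[OF X] by (metis empty_iff)
  qed
  from bchoice[OF this] obtain V where V: "\<And>B. B \<in> \<B>' \<Longrightarrow> openin X (V B)" 
    "\<And>B. B \<in> \<B>' \<Longrightarrow> V B \<noteq> {}" "\<And>B. B \<in> \<B>' \<Longrightarrow> X closure_of V B \<subseteq> B" by blast
  have "(UNIV :: real set) \<lesssim> f ` (X closure_of V B)" if B: "B \<in> \<B>'" for B
  proof (rule image_closure_continuum[OF X(1) Hausdorff_space_euclidean f V(1)[OF B] V(2)[OF B]])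
    fix U assume U: "openin X U" "U \<noteq> {}" "U \<subseteq> V B"
    have "V B \<subseteq> X closure_of V B" by (rule closure_of_subset[OF openin_subset[OF V(1)[OF B]]])
    then have "U \<subseteq> B" using U(3) V(3)[OF B] by blast
    then have "no_isolated_points_in X U" using B by (auto simp: \<B>'_def I_def no_isolated_points_in_def)
    then show "infinite (f ` U)" by (rule rich[OF U(1,2)])
  qed
  moreover have "\<B>' \<lesssim> (UNIV :: real set)"
    by (rule lepoll_trans[OF subset_imp_lepoll \<B>(2)]) (auto simp: \<B>'_def)
  ultimately have "\<exists>h. inj_on h \<B>' \<and> (\<forall>B\<in>\<B>'. h B \<in> f ` (X closure_of V B))"
    by (intro injective_choice_continuum)
  then obtain h where h: "inj_on h \<B>'" "\<And>B. B \<in> \<B>' \<Longrightarrow> h B \<in> f ` (X closure_of V B)"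
    by (elim exE conjE) simp
  define W where "W B m = {x \<in> V B. dist (h B) (f x) < 1 / Suc m}" for B and m :: nat
  define N where "N B m a = W B m \<inter> (\<Inter>t\<in>a. X exterior_of (E t))" for B m a
  have Eop: "openin X (E s)" if "s \<in> S" for s using E that regular_open_openin by blast
  have "\<exists>y. y \<in> X closure_of V B \<and> f y = h B \<and> (\<forall>s\<in>S. y \<in> E s \<longrightarrow> 
      (\<exists>m a. finite a \<and> a \<subseteq> {t\<in>S. (t, s) \<in> L} \<and> N B m a \<noteq> {} \<and> N B m a \<inter> X exterior_of (E s) = {}))"
    if B: "B \<in> \<B>'" for B
    unfolding N_def W_def
    by (rule greedy_point[OF X(1) f L Eop V(1)[OF B] h(2)[OF B]])
  then have "\<forall>B\<in>\<B>'. \<exists>y. y \<in> X closure_of V B \<and> f y = h B \<and> (\<forall>s\<in>S. y \<in> E s \<longrightarrow> 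
      (\<exists>m a. finite a \<and> a \<subseteq> {t\<in>S. (t, s) \<in> L} \<and> N B m a \<noteq> {} \<and> N B m a \<inter> X exterior_of (E s) = {}))"
    by (rule ballI)
  from bchoice[OF this] obtain y where yy: "\<forall>B\<in>\<B>'. y B \<in> X closure_of V B \<and> f (y B) = h B \<and> (\<forall>s\<in>S. y B \<in> E s \<longrightarrow> 
      (\<exists>m a. finite a \<and> a \<subseteq> {t\<in>S. (t, s) \<in> L} \<and> N B m a \<noteq> {} \<and> N B m a \<inter> X exterior_of (E s) = {}))"
    by (elim exE)
  then have y: "\<And>B. B \<in> \<B>' \<Longrightarrow> y B \<in> X closure_of V B" "\<And>B. B \<in> \<B>' \<Longrightarrow> f (y B) = h B"
    and yE: "\<And>B s. B \<in> \<B>' \<Longrightarrow> s \<in> S \<Longrightarrow> y B \<in> E s \<Longrightarrow> 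
      \<exists>m a. finite a \<and> a \<subseteq> {t\<in>S. (t, s) \<in> L} \<and> N B m a \<noteq> {} \<and> N B m a \<inter> X exterior_of (E s) = {}"
    by simp_all
  have yB: "y B \<in> B" "y B \<in> topspace X" if "B \<in> \<B>'" for B
    using y(1)[OF that] V(3)[OF that] closure_of_subset_topspace[of X "V B"] by auto
  define Y where "Y = I \<union> y ` \<B>'"
  have IX: "I \<subseteq> topspace X" using openin_subset by (fastforce simp: I_def)
  have "dense_subset X Y"
    unfolding dense_subset_iff
  proof (intro conjI allI impI)
    show "Y \<subseteq> topspace X" using IX yB by (auto simp: Y_def)
    fix U assume "openin X U" "U \<noteq> {}"
    then obtain B where B: "B \<in> \<B>" "B \<subseteq> U" "B \<noteq> {}" using \<B>(1) unfolding pi_base_def by metis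
    show "U \<inter> Y \<noteq> {}"
    proof (cases "B \<inter> I = {}")
      case True
      then have "B \<in> \<B>'" using B by (simp add: \<B>'_def)
      then have "y B \<in> U \<inter> Y" using yB B by (auto simp: Y_def)
      then show ?thesis by blast
    qed (use B in \<open>auto simp: Y_def\<close>)
  qed
  then obtain \<K> where \<K>: "countable \<K>" "\<And>K. K \<in> \<K> \<Longrightarrow> compactin X K \<and> K \<subseteq> Y"
     "dense_subset X (\<Union>\<K>)"
    using K unfolding dense_sets_k_separable_def by metis
  have injY: "inj_on f Y"
  proof (rule inj_onI)
    fix p q assume p: "p \<in> Y" and q: "q \<in> Y" and fpq: "f p = f q"
    have pq: "p \<in> topspace X" "q \<in> topspace X" using p q IX yB by (auto simp: Y_def)
    consider "p \<in> I" | "q \<in> I" | A B where "A \<in> \<B>'" "B \<in> \<B>'" "p = y A" "q = y B"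
      using p q by (auto simp: Y_def)
    then show "p = q"
    proof cases
      case 1 then show ?thesis using iso[of p q] pq fpq by (simp add: I_def)
    next
      case 2 then show ?thesis using iso[of q p] pq fpq by (simp add: I_def)
    next
      case 3
      then have "h A = h B" using y(2) fpq by metis
      then have "A = B" using 3 h(1) by (simp add: inj_on_def)
      then show ?thesis using 3 by simp
    qed
  qed
  have "\<forall>K\<in>\<K>. \<exists>D. countable D \<and> D \<subseteq> K \<and> K \<subseteq> X closure_of D"
  proof
    fix K assume "K \<in> \<K>"
    then have "compactin X K" "inj_on f K" using \<K>(2) injY inj_on_subset by blast+
    then show "\<exists>D. countable D \<and> D \<subseteq> K \<and> K \<subseteq> X closure_of D"
      using compactin_separable_by_injection[OF _ f] by metis
  qed
  from bchoice[OF this] obtain D' where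
    "\<forall>K\<in>\<K>. countable (D' K) \<and> D' K \<subseteq> K \<and> K \<subseteq> X closure_of (D' K)" by (elim exE)
  then have D': "\<And>K. K \<in> \<K> \<Longrightarrow> countable (D' K)" 
    "\<And>K. K \<in> \<K> \<Longrightarrow> D' K \<subseteq> K" "\<And>K. K \<in> \<K> \<Longrightarrow> K \<subseteq> X closure_of (D' K)" by simp_all
  define D where "D = (\<Union>K\<in>\<K>. D' K)"
  have cD: "countable D" using \<K>(1) D'(1) by (simp add: D_def)
  have DY: "D \<subseteq> Y" unfolding D_def using D'(2) \<K>(2) by blast
  have Ddense: "U \<inter> D \<noteq> {}" if U: "openin X U" "U \<noteq> {}" for U
  proof -
    have "U \<inter> \<Union>\<K> \<noteq> {}" using U \<K>(3) by (simp add: dense_subset_iff)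
    then obtain K x where "K \<in> \<K>" "x \<in> U" "x \<in> K" by auto
    then have "U \<inter> D' K \<noteq> {}" using open_meets_closure[OF U(1), of x "D' K"] D'(3)[of K] by auto
    then show ?thesis using \<open>K \<in> \<K>\<close> by (auto simp: D_def)
  qed
  define \<B>D where "\<B>D = {B \<in> \<B>'. y B \<in> D}"
  have "countable \<B>D"
  proof (rule countable_image_inj_on)
    show "countable (y ` \<B>D)" by (rule countable_subset[OF _ cD]) (auto simp: \<B>D_def)
    show "inj_on y \<B>D"
    proof (rule inj_onI)
      fix A B assume "A \<in> \<B>D" "B \<in> \<B>D" "y A = y B"
      then have "A \<in> \<B>'" "B \<in> \<B>'" "h A = h B" using y(2) by (auto simp: \<B>D_def) metis
      then show "A = B" using h(1) unfolding inj_on_def by blast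
    qed
  qed
  \<comment> \<open>The regularization, that is, the interior of the closure.\<close>
  define reg where "reg U = X exterior_of (X exterior_of U)" for U
  define C where "C = (\<lambda>d. reg {d}) ` (D \<inter> I) \<union> (\<lambda>(B, m). reg (W B m)) ` (\<B>D \<times> UNIV)"
  have Wop: "openin X (W B m)" if "B \<in> \<B>'" for B m
  proof -
    have "openin X {x \<in> topspace X. f x \<in> ball (h B) (1 / Suc m)}"
      using f by (auto simp: continuous_map_def)
    then have "openin X (V B \<inter> {x \<in> topspace X. f x \<in> ball (h B) (1 / Suc m)})"
      using V(1)[OF that] by blast
    moreover have "V B \<inter> {x \<in> topspace X. f x \<in> ball (h B) (1 / Suc m)} = W B m"
      using openin_subset[OF V(1)[OF that]] by (auto simp: W_def)
    ultimately show ?thesis by simp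
  qed
  have "countable C" using cD \<open>countable \<B>D\<close> by (simp add: C_def)
  moreover have "regular_open X c" if "c \<in> C" for c
    using that by (auto simp: C_def reg_def regular_open_exterior_of)
  moreover have "\<exists>c\<in>C. \<exists>a. finite a \<and> a \<subseteq> {t\<in>S. (t, s) \<in> L} \<and>
             c \<inter> (\<Inter>t\<in>a. X exterior_of (E t)) \<noteq> {} \<and>
             c \<inter> (\<Inter>t\<in>a. X exterior_of (E t)) \<subseteq> E s" if s: "s \<in> S" for s
  proof -
    have Es: "openin X (E s)" "E s \<noteq> {}" "reg (E s) = E s"
      using Eop[OF s] E s by (auto simp: reg_def regular_open_def)
    obtain d where d: "d \<in> D" "d \<in> E s" using Ddense[OF Es(1,2)] by blast
    show ?thesis
    proof (cases "d \<in> I")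
      case True
      have "{d} \<subseteq> reg {d}" unfolding reg_def using True by (intro open_subset_double_exterior) (simp add: I_def)
      moreover have "reg {d} \<subseteq> reg (E s)" unfolding reg_def using d by (intro exterior_of_mono) auto
      moreover have "reg {d} \<in> C" using d True by (auto simp: C_def)
      ultimately show ?thesis using Es(3) by (intro bexI[of _ "reg {d}"] exI[of _ "{}"]) auto
    next
      case False
      then obtain B where B: "B \<in> \<B>'" "d = y B" using d(1) DY by (auto simp: Y_def)
      then obtain m a where ma: "finite a" "a \<subseteq> {t\<in>S. (t, s) \<in> L}" "N B m a \<noteq> {}" 
         "N B m a \<inter> X exterior_of (E s) = {}"
        using yE[OF B(1) s] d(2) by blast
      define c where "c = reg (W B m)"
      have cop: "openin X c" by (simp add: c_def reg_def)
      have "c \<in> C" using B d(1) by (auto simp: C_def c_def \<B>D_def)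
      have Wc: "W B m \<subseteq> c" unfolding c_def reg_def using Wop[OF B(1)] by (rule open_subset_double_exterior)
      define Q where "Q = c \<inter> (\<Inter>t\<in>a. X exterior_of (E t))"
      have Qop: "openin X Q"
      proof (cases "a = {}")
        case False
        have "openin X (\<Inter>t\<in>a. X exterior_of (E t))"
          using ma(1) False by (intro openin_Inter) auto
        then show ?thesis using cop by (simp add: Q_def openin_Int)
      qed (use cop in \<open>simp add: Q_def\<close>)
      have "(Q \<inter> X exterior_of (E s)) \<inter> W B m = {}"
        using ma(4) by (auto simp: Q_def N_def)
      then have "Q \<inter> X exterior_of (E s) \<subseteq> X exterior_of (W B m)"
        using Qop by (intro exterior_of_maximal) auto
      moreover have "c \<inter> X exterior_of (W B m) = {}"
        using exterior_of_disjoint[of "X exterior_of (W B m)" X] exterior_of_subset_topspace[of X "W B m"]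
        unfolding c_def reg_def by blast
      ultimately have "Q \<inter> X exterior_of (E s) = {}" by (auto simp: Q_def)
      then have "Q \<subseteq> reg (E s)" unfolding reg_def by (rule exterior_of_maximal[OF Qop])
      moreover have "N B m a \<subseteq> Q" using Wc by (auto simp: N_def Q_def)
      ultimately have "Q \<noteq> {}" "Q \<subseteq> E s" using ma(3) Es(3) by auto
      then show ?thesis using ma(1,2) \<open>c \<in> C\<close> unfolding Q_def
        by (intro bexI[of _ c] exI[of _ a]) simp_all
    qed
  qed
  ultimately show "\<exists>C. countable C \<and> (\<forall>c\<in>C. regular_open X c) \<and>
          (\<forall>s\<in>S. \<exists>c\<in>C. \<exists>a. finite a \<and> a \<subseteq> {t\<in>S. (t, s) \<in> L} \<and>
             c \<inter> (\<Inter>t\<in>a. X exterior_of (E t)) \<noteq> {} \<and>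
             c \<inter> (\<Inter>t\<in>a. X exterior_of (E t)) \<subseteq> E s)"
    by (intro exI[of _ C] conjI ballI)
qed

lemma regular_open_in_open:
  assumes "compact_space X" "Hausdorff_space X" "openin X U" "U \<noteq> {}"
  shows "\<exists>V. regular_open X V \<and> V \<noteq> {} \<and> V \<subseteq> U"
proof -
  obtain x where "x \<in> U" using assms by blast
  then obtain W where W: "openin X W" "x \<in> W" "X closure_of W \<subseteq> U"
    using compact_Hausdorff_open_shrink assms by metis
  define V where "V = X exterior_of (X exterior_of W)"
  have "V \<subseteq> X closure_of W"
    using closure_of_subset[of "X exterior_of W" X] exterior_of_subset_topspace[of X W]
    unfolding V_def exterior_of_def[of X "X exterior_of W"] by (auto simp: exterior_of_def)
  moreover have "W \<subseteq> V" unfolding V_def by (rule open_subset_double_exterior[OF W(1)])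
  moreover have "regular_open X V" unfolding V_def by (intro regular_open_exterior_of) simp
  ultimately show ?thesis using W by (intro exI[of _ V]) blast
qed

text \<open>
  A map as in the assumptions on \<open>f\<close> is called \<^emph>\<open>rich\<close>: it separates isolated points from all other points, and it
  has infinitely many values on every nonempty open set without isolated points.
\<close>
lemma countable_pi_base_of_rich_map:
  fixes f :: "'a \<Rightarrow> 'm::{metric_space,second_countable_topology}"
  assumes X: "compact_space X" "Hausdorff_space X" and K: "dense_sets_k_separable X"
    and \<B>: "pi_base X \<B>" "\<B> \<lesssim> (UNIV :: real set)"
    and f: "continuous_map X euclidean f"
    and iso: "\<And>i x. openin X {i} \<Longrightarrow> x \<in> topspace X \<Longrightarrow> f x = f i \<Longrightarrow> x = i"
    and rich: "\<And>U. openin X U \<Longrightarrow> U \<noteq> {} \<Longrightarrow> no_isolated_points_in X U \<Longrightarrow> infinite (f ` U)"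
  shows "\<exists>\<C>. countable \<C> \<and> pi_base X \<C>"
proof -
  have "countably_refinable X TYPE('a set \<times> 'a set)"
    by (rule k_separable_countably_refinable[OF X K \<B> f]) (fact iso, fact rich)
  from countable_refinement_of_regular_opens[OF this]
  obtain C where C: "countable C" "\<forall>c\<in>C. openin X c \<and> c \<noteq> {}"
     "\<forall>U. regular_open X U \<longrightarrow> U \<noteq> {} \<longrightarrow> (\<exists>c\<in>C. c \<subseteq> U)"
    by (elim exE conjE)
  have "\<exists>c\<in>C. c \<subseteq> U" if U: "openin X U" "U \<noteq> {}" for U
  proof -
    from regular_open_in_open[OF X U]
    obtain V where V: "regular_open X V" "V \<noteq> {}" "V \<subseteq> U" by (elim exE conjE)
    from C(3)[rule_format, OF V(1,2)] obtain c where "c \<in> C" "c \<subseteq> V" by (elim bexE)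
    then show ?thesis using V(3) by (intro bexI[of _ c]) auto
  qed
  then show ?thesis using C by (auto simp: pi_base_def)
qed

section \<open>Existence of a rich map\<close>

lemma compact_Hausdorff_cozero:
  assumes "compact_space X" "Hausdorff_space X" "openin X U" "x \<in> U"
  shows "\<exists>\<phi>. continuous_map X euclideanreal \<phi> \<and> \<phi> x = 1 \<and> {z \<in> topspace X. \<phi> z \<noteq> 0} \<subseteq> U"
proof -
  have "completely_regular_space X"
    using assms compact_Hausdorff_or_regular_imp_normal_space normal_imp_completely_regular_space by blast
  moreover have x: "x \<in> topspace X" using assms openin_subset by blast
  moreover have "closedin X (topspace X - U)" using assms by blast
  moreover have "disjnt {x} (topspace X - U)" using assms by simp
  ultimately obtain f where "continuous_map X euclideanreal f" "f ` (topspace X - U) \<subseteq> {0}" "f ` {x} \<subseteq> {1}"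
    using Urysohn_completely_regular_compact_closed_alt[of X "{x}" "topspace X - U" 0 1] by auto
  then show ?thesis by (intro exI[of _ f]) auto
qed

lemma continuous_map_into_sequences:
  fixes f :: "'a \<Rightarrow> nat \<Rightarrow> real"
  shows "continuous_map X euclidean f \<longleftrightarrow> (\<forall>k. continuous_map X euclidean (\<lambda>x. f x k))"
  unfolding euclidean_product_topology[symmetric] by (simp add: continuous_map_componentwise_UNIV)

text \<open>The diagonal map, with the sequences of sequences flattened to sequences.\<close>
lemma combine_continuous_maps:
  fixes \<G> :: "('a \<Rightarrow> nat \<Rightarrow> real) set"
  assumes "countable \<G>" "\<And>g. g \<in> \<G> \<Longrightarrow> continuous_map X euclidean g"
  shows "\<exists>f :: 'a \<Rightarrow> nat \<Rightarrow> real. continuous_map X euclidean f \<and>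
     (\<forall>g\<in>\<G>. \<forall>x y. f x = f y \<longrightarrow> g x = g y)"
proof -
  define \<G>' where "\<G>' = insert (\<lambda>x k. 0) \<G>"
  define e where "e = from_nat_into \<G>'"
  define f where "f x k = e (fst (prod_decode k)) x (snd (prod_decode k))" for x k
  have "\<G>' \<noteq> {}" "countable \<G>'" using assms(1) by (auto simp: \<G>'_def)
  then have e: "range e = \<G>'" unfolding e_def by (rule range_from_nat_into)
  have "continuous_map X euclidean (e n)" for n
  proof -
    have "e n \<in> \<G>'" using e by blast
    then show ?thesis using assms(2) by (auto simp: \<G>'_def continuous_map_into_sequences)
  qed
  then have "continuous_map X euclidean f"
    unfolding continuous_map_into_sequences f_def by blast
  moreover have "g x = g y" if "g \<in> \<G>" "f x = f y" for g x y
  proof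
    fix j
    have "g \<in> range e" using that(1) unfolding e \<G>'_def by blast
    then obtain n where n: "g = e n" by blast
    have "f x (prod_encode (n, j)) = f y (prod_encode (n, j))" using that(2) by simp
    then show "g x j = g y j" by (simp add: f_def n)
  qed
  ultimately show ?thesis by blast
qed

lemma infinite_image_factor:
  assumes "infinite (g ` U)" "\<And>x y. f x = f y \<Longrightarrow> g x = g y"
  shows "infinite (f ` U)"
proof
  assume fin: "finite (f ` U)"
  have "g ` U \<subseteq> (\<lambda>v. g (SOME x. f x = v)) ` f ` U"
  proof
    fix w assume "w \<in> g ` U"
    then obtain x where x: "x \<in> U" "w = g x" by blast
    have "f (SOME x'. f x' = f x) = f x" by (rule someI) simp
    then have "g (SOME x'. f x' = f x) = w" using assms(2) x by blast
    then show "w \<in> (\<lambda>v. g (SOME x. f x = v)) ` f ` U" using x(1) by blast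
  qed
  then show False using fin assms(1) finite_subset by blast
qed

lemma finite_open_has_isolated_points:
  assumes "Hausdorff_space X" "openin X U" "finite U" "x \<in> U"
  shows "openin X {x}"
proof -
  have "U - {x} \<subseteq> topspace X" using openin_subset[OF assms(2)] by blast
  then have "closedin X (U - {x})"
    using assms Hausdorff_imp_t1_space t1_space_closedin_finite by blast
  then have "openin X (U - (U - {x}))" using assms(2) by blast
  moreover have "U - (U - {x}) = {x}" using assms(4) by blast
  ultimately show ?thesis by simp
qed

text \<open>
  Maps into sequences of reals are considered in order to treat countably many real functions at once.
\<close>
definition all_maps_constant_somewhere :: "'a topology \<Rightarrow> 'a set \<Rightarrow> bool" where
  "all_maps_constant_somewhere X G \<longleftrightarrow>
     (\<forall>g :: 'a \<Rightarrow> nat \<Rightarrow> real. continuous_map X euclidean g \<longrightarrow>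
        (\<exists>W. openin X W \<and> W \<noteq> {} \<and> W \<subseteq> G \<and> (\<forall>x\<in>W. \<forall>y\<in>W. g x = g y)))"

text \<open>The finitely many values are isolated from each other.\<close>
lemma constant_on_open_of_finite_image:
  fixes g :: "'a \<Rightarrow> 'm::metric_space"
  assumes g: "continuous_map X euclidean g" and U: "openin X U" "U \<noteq> {}" "finite (g ` U)"
  shows "\<exists>W. openin X W \<and> W \<noteq> {} \<and> W \<subseteq> U \<and> (\<forall>x\<in>W. \<forall>y\<in>W. g x = g y)"
proof -
  obtain x where x: "x \<in> U" using U(2) by blast
  define T where "T = g ` U - {g x}"
  define W where "W = U \<inter> {z \<in> topspace X. g z \<in> - T}"
  have "finite T" using U(3) by (simp add: T_def)
  then have "open (- T)" by (intro open_Compl finite_imp_closed)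
  then have "openin X {z \<in> topspace X. g z \<in> - T}"
    using openin_continuous_map_preimage[OF g, of "- T"] by simp
  then have W: "openin X W" unfolding W_def using U(1) by (rule openin_Int[rotated])
  have "x \<in> W" using x openin_subset[OF U(1)] by (auto simp: T_def W_def)
  then have ne: "W \<noteq> {}" by blast
  have c: "g z = g x" if "z \<in> W" for z
  proof -
    have "g z \<in> g ` U" "g z \<notin> T" using that by (auto simp: W_def)
    then show ?thesis unfolding T_def by blast
  qed
  have "\<forall>y\<in>W. \<forall>z\<in>W. g y = g z"
  proof (intro ballI)
    fix y z assume "y \<in> W" "z \<in> W"
    then show "g y = g z" using c[of y] c[of z] by simp
  qed
  moreover have "W \<subseteq> U" by (simp add: W_def)
  ultimately show ?thesis using W ne by (intro exI[of _ W] conjI)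
qed

text \<open>
  A second use of the hypothesis. An open set \<open>G\<close> without isolated points has a dense subset with dense complement in \<open>G\<close>: each
  member of the \<open>\<pi>\<close>-base inside \<open>G\<close> has continuum many points, so two points can be chosen in each of them, all
  distinct. Together with the complement of \<open>G\<close>, the first points form a dense set \<open>Y\<close>, and compact subsets \<open>K\<close> of \<open>Y\<close>
  have no interior in \<open>G\<close>. For each of countably many such \<open>K\<close>, countably many cozero sets fill \<open>G - K\<close>
  up to a set without interior. If the corresponding countably many functions are all constant on an
  open set \<open>W\<close>, then \<open>W\<close> is contained in one of the cozero sets for each \<open>K\<close>, so \<open>W\<close> misses every \<open>K\<close>, and the
  union of the \<open>K\<close> is not dense.
\<close>
lemma not_all_maps_constant_somewhere:
  assumes X: "compact_space X" "Hausdorff_space X" and K: "dense_sets_k_separable X"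
    and \<B>: "pi_base X \<B>" "\<B> \<lesssim> (UNIV :: real set)"
    and G: "openin X G" "no_isolated_points_in X G"
  shows "\<not> all_maps_constant_somewhere X G"
proof
  assume lc: "all_maps_constant_somewhere X G"
  have ccc: "countable_cellularity X" using K by (rule k_separable_imp_countable_cellularity)
  define \<B>G where "\<B>G = {B \<in> \<B>. B \<subseteq> G}"
  have \<B>G: "openin X B" "B \<noteq> {}" "B \<subseteq> G" if "B \<in> \<B>G" for B
    using that \<B>(1) by (auto simp: \<B>G_def pi_base_def)
  have inG: "\<exists>B\<in>\<B>G. B \<subseteq> U" if U: "openin X U" "U \<noteq> {}" "U \<subseteq> G" for U
  proof -
    obtain B where "B \<in> \<B>" "B \<subseteq> U" using \<B>(1) U(1,2) unfolding pi_base_def by metis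
    then show ?thesis using U(3) by (auto simp: \<B>G_def)
  qed
  have big: "(UNIV :: real set) \<lesssim> fst i" if i: "i \<in> \<B>G \<times> (UNIV :: bool set)" for i
  proof -
    define B where "B = fst i"
    have B: "B \<in> \<B>G" using i by (auto simp: B_def)
    obtain x where x: "x \<in> B" using \<B>G(2)[OF B] by blast
    obtain V where V: "openin X V" "x \<in> V" "X closure_of V \<subseteq> B"
      using compact_Hausdorff_open_shrink[OF X \<B>G(1)[OF B] x] .
    have VV: "V \<subseteq> X closure_of V" by (rule closure_of_subset[OF openin_subset[OF V(1)]])
    have inf: "infinite (id ` U)" if U: "openin X U" "U \<noteq> {}" "U \<subseteq> V" for U
    proof
      assume "finite (id ` U)"
      then have "finite U" by simp
      then have "\<forall>x\<in>U. openin X {x}" using finite_open_has_isolated_points[OF X(2) U(1)] by blast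
      moreover have "U \<subseteq> G" using U(3) VV V(3) \<B>G(3)[OF B] by blast
      ultimately show False using U(2) G(2) unfolding no_isolated_points_in_def by blast
    qed
    have "(UNIV :: real set) \<lesssim> id ` (X closure_of V)"
    proof (rule image_closure_continuum[OF X(1) X(2) _ V(1)])
      show "continuous_map X X id" by simp
      show "V \<noteq> {}" using V by blast
    qed (rule inf)
    then show ?thesis using lepoll_trans subset_imp_lepoll[OF V(3)] unfolding B_def by simp
  qed
  have "\<B>G \<times> (UNIV :: bool set) \<lesssim> (UNIV :: real set)"
  proof -
    have "\<B>G \<lesssim> (UNIV :: real set)" by (rule lepoll_trans[OF subset_imp_lepoll \<B>(2)]) (auto simp: \<B>G_def)
    then obtain i where i: "inj_on i \<B>G" "i ` \<B>G \<subseteq> (UNIV :: real set)" by (auto simp: lepoll_def)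
    \<comment> \<open>The arctangent maps the line injectively into a bounded interval, so two disjoint copies fit.\<close>
    define j where "j = (\<lambda>(B, b). (arctan (i B)) + (if b then 10 else 0))"
    have "inj_on j (\<B>G \<times> UNIV)"
    proof (rule inj_onI)
      fix p q assume p: "p \<in> \<B>G \<times> (UNIV::bool set)" and q: "q \<in> \<B>G \<times> (UNIV::bool set)" and e: "j p = j q"
      obtain A a B b where pq: "p = (A, a)" "q = (B, b)" by (metis surj_pair)
      have "pi < 4" using pi_less_4 .
      then have "a = b" using e arctan_bounded[of "i A"] arctan_bounded[of "i B"]
        by (auto simp: j_def pq split: if_splits)
      then have "i A = i B" using e by (auto simp: j_def pq arctan_eq_iff split: if_splits)
      then have "A = B" using i(1) p q unfolding pq inj_on_def by blast
      then show "p = q" using \<open>a = b\<close> pq by simp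
    qed
    then show ?thesis unfolding lepoll_def by blast
  qed
  then have "\<exists>h. inj_on h (\<B>G \<times> (UNIV :: bool set)) \<and> (\<forall>i\<in>\<B>G \<times> UNIV. h i \<in> fst i)"
    by (rule injective_choice_continuum) (rule big)
  then obtain h where h: "inj_on h (\<B>G \<times> (UNIV :: bool set))" "\<forall>i\<in>\<B>G \<times> UNIV. h i \<in> fst i"
    by (elim exE conjE)
  define Y where "Y = (\<lambda>B. h (B, True)) ` \<B>G \<union> (topspace X - G)"
  have "dense_subset X Y"
    unfolding dense_subset_iff
  proof (intro conjI allI impI)
    have "h (B, True) \<in> topspace X" if "B \<in> \<B>G" for B
      using h(2) that \<B>G(3)[OF that] openin_subset[OF G(1)] by force
    then show "Y \<subseteq> topspace X" by (auto simp: Y_def)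
    fix U assume U: "openin X U" "U \<noteq> {}"
    show "U \<inter> Y \<noteq> {}"
    proof (cases "U \<inter> G = {}")
      case True
      then have "U \<subseteq> topspace X - G" using openin_subset[OF U(1)] by blast
      then show ?thesis using U(2) by (auto simp: Y_def)
    next
      case False
      then obtain B where B: "B \<in> \<B>G" "B \<subseteq> U \<inter> G" using inG[of "U \<inter> G"] U G by auto
      then have "h (B, True) \<in> U \<inter> Y" using h(2) by (fastforce simp: Y_def)
      then show ?thesis by blast
    qed
  qed
  then obtain \<K> where \<K>: "countable \<K>" "\<And>K. K \<in> \<K> \<Longrightarrow> compactin X K \<and> K \<subseteq> Y"
     "dense_subset X (\<Union>\<K>)"
    using K unfolding dense_sets_k_separable_def by metis
  have Kcl: "closedin X K" if "K \<in> \<K>" for K using \<K>(2)[OF that] compactin_imp_closedin[OF X(2)] by blast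
  have nwd: "U - K \<noteq> {}" if "K \<in> \<K>" and U: "openin X U" "U \<noteq> {}" "U \<subseteq> G" for K U
  proof -
    obtain B where B: "B \<in> \<B>G" "B \<subseteq> U" using inG[OF U] by (elim bexE)
    have hB: "h (B, False) \<in> B" using h(2) B by force
    have "h (B, False) \<notin> Y"
    proof
      assume "h (B, False) \<in> Y"
      moreover have "h (B, False) \<in> G" using hB B(2) U(3) by blast
      ultimately obtain A where A: "A \<in> \<B>G" "h (B, False) = h (A, True)" by (auto simp: Y_def)
      have "(B, False) = (A, True)" by (rule inj_onD[OF h(1) A(2)]) (use A B in auto)
      then show False by simp
    qed
    then have "h (B, False) \<notin> K" using \<K>(2)[OF that(1)] by blast
    then show ?thesis using hB B(2) by blast
  qed
  define coz where "coz \<phi> = {z \<in> topspace X. \<phi> z \<noteq> (0::real)}" for \<phi>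
  define cz where "cz K = {coz \<phi> |\<phi>. continuous_map X euclidean \<phi> \<and> coz \<phi> \<subseteq> G - K}" for K
  have "\<forall>K\<in>\<K>. \<exists>\<U>. \<U> \<subseteq> cz K - {{}} \<and> disjoint \<U> \<and> (\<forall>P\<in>cz K - {{}}. \<exists>U\<in>\<U>. P \<inter> U \<noteq> {})"
  proof
    fix K assume "K \<in> \<K>"
    obtain \<U> where "\<U> \<subseteq> cz K - {{}}" "disjoint \<U>" "\<And>P. P \<in> cz K - {{}} \<Longrightarrow> P \<noteq> {} \<Longrightarrow> \<exists>U\<in>\<U>. P \<inter> U \<noteq> {}"
      using maximal_disjoint_subfamily[of "cz K - {{}}"] by metis
    then show "\<exists>\<U>. \<U> \<subseteq> cz K - {{}} \<and> disjoint \<U> \<and> (\<forall>P\<in>cz K - {{}}. \<exists>U\<in>\<U>. P \<inter> U \<noteq> {})" by blast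
  qed
  from bchoice[OF this] obtain \<U> where \<U>: "\<forall>K\<in>\<K>. \<U> K \<subseteq> cz K - {{}} \<and> disjoint (\<U> K) \<and> 
     (\<forall>P\<in>cz K - {{}}. \<exists>U\<in>\<U> K. P \<inter> U \<noteq> {})" by (elim exE)
  have cozop: "openin X (coz \<phi>)" if "continuous_map X euclidean \<phi>" for \<phi>
  proof -
    have "openin X {z \<in> topspace X. \<phi> z \<in> - {0}}"
      using openin_continuous_map_preimage[OF that, of "- {0}"] by (simp add: open_Compl)
    then show ?thesis by (simp add: coz_def)
  qed
  have cU: "countable (\<U> K)" if "K \<in> \<K>" for K
  proof -
    have "disjoint (\<U> K)" using \<U> that by blast
    moreover have "\<forall>U\<in>\<U> K. openin X U \<and> U \<noteq> {}"
    proof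
      fix U assume "U \<in> \<U> K"
      then have "U \<in> cz K - {{}}" using \<U> that by blast
      then show "openin X U \<and> U \<noteq> {}" using cozop by (auto simp: cz_def)
    qed
    ultimately show ?thesis using ccc unfolding countable_cellularity_def by blast
  qed
  define \<Q> where "\<Q> = (\<Union>K\<in>\<K>. \<U> K)"
  have cQ: "countable \<Q>" using cU \<K>(1) by (simp add: \<Q>_def)
  have "\<forall>Q\<in>\<Q>. \<exists>\<phi>. continuous_map X euclidean \<phi> \<and> coz \<phi> = Q"
  proof
    fix Q assume "Q \<in> \<Q>"
    then obtain K where K: "K \<in> \<K>" "Q \<in> \<U> K" by (auto simp: \<Q>_def)
    then have "Q \<in> cz K - {{}}" using \<U> by blast
    then show "\<exists>\<phi>. continuous_map X euclidean \<phi> \<and> coz \<phi> = Q" by (auto simp: cz_def)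
  qed
  from bchoice[OF this] obtain \<phi> where 
    \<phi>: "\<forall>Q\<in>\<Q>. continuous_map X euclidean (\<phi> Q) \<and> coz (\<phi> Q) = Q" by (elim exE)
  define \<G> where "\<G> = (\<lambda>Q x (k::nat). \<phi> Q x) ` \<Q>"
  have "countable \<G>" using cQ by (simp add: \<G>_def)
  moreover have "continuous_map X euclidean g" if "g \<in> \<G>" for g
    using that \<phi> by (auto simp: \<G>_def continuous_map_into_sequences)
  ultimately have "\<exists>f :: 'a \<Rightarrow> nat \<Rightarrow> real. continuous_map X euclidean f \<and>
     (\<forall>g\<in>\<G>. \<forall>x y. f x = f y \<longrightarrow> g x = g y)" by (rule combine_continuous_maps)
  then obtain f :: "'a \<Rightarrow> nat \<Rightarrow> real" where f: "continuous_map X euclidean f"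
     "\<forall>g\<in>\<G>. \<forall>x y. f x = f y \<longrightarrow> g x = g y" by (elim exE conjE)
  from lc[unfolded all_maps_constant_somewhere_def, rule_format, OF f(1)]
  obtain W where W: "openin X W" "W \<noteq> {}" "W \<subseteq> G" "\<forall>x\<in>W. \<forall>y\<in>W. f x = f y" by (elim exE conjE)
  have "W \<inter> K = {}" if K: "K \<in> \<K>" for K
  proof -
    have op: "openin X (W - K)" using W(1) Kcl[OF K] by blast
    obtain x where x: "x \<in> W - K" using nwd[OF K W(1-3)] by blast
    from compact_Hausdorff_cozero[OF X op x] obtain \<psi> where
      \<psi>: "continuous_map X euclideanreal \<psi>" "\<psi> x = 1" "{z \<in> topspace X. \<psi> z \<noteq> 0} \<subseteq> W - K" by (elim exE conjE)
    have xt: "x \<in> topspace X" using x openin_subset[OF W(1)] by blast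
    have "coz \<psi> \<subseteq> G - K" using \<psi>(3) W(3) unfolding coz_def by blast
    then have "coz \<psi> \<in> cz K - {{}}" using \<psi> xt by (auto simp: cz_def coz_def)
    then obtain Q where Q: "Q \<in> \<U> K" "coz \<psi> \<inter> Q \<noteq> {}" using \<U> K by blast
    then have "Q \<in> \<Q>" using K by (auto simp: \<Q>_def)
    have "Q \<in> cz K" using \<U> K Q(1) by blast
    then have QK: "Q \<subseteq> G - K" by (auto simp: cz_def)
    obtain z where z: "z \<in> W" "z \<in> Q" using Q(2) \<psi>(3) unfolding coz_def by blast
    have const: "\<phi> Q z' = \<phi> Q z" if "z' \<in> W" for z'
    proof -
      have "(\<lambda>x (k::nat). \<phi> Q x) \<in> \<G>" using \<open>Q \<in> \<Q>\<close> by (auto simp: \<G>_def)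
      moreover have "f z' = f z" using W(4) z that by blast
      ultimately have "(\<lambda>x (k::nat). \<phi> Q x) z' = (\<lambda>x (k::nat). \<phi> Q x) z"
        using f(2)[rule_format, of "\<lambda>x (k::nat). \<phi> Q x" z' z] by simp
      then show ?thesis by (rule fun_cong)
    qed
    have cQ: "coz (\<phi> Q) = Q" using \<phi> \<open>Q \<in> \<Q>\<close> by blast
    have "z \<in> coz (\<phi> Q)" using z(2) cQ by simp
    then have "\<phi> Q z \<noteq> 0" by (simp add: coz_def)
    then have "W \<subseteq> coz (\<phi> Q)"
      using const openin_subset[OF W(1)] unfolding coz_def by auto
    then have "W \<subseteq> Q" using cQ by simp
    then show ?thesis using QK by blast
  qed
  then have "W \<inter> \<Union>\<K> = {}" by blast
  then show False using W(1,2) \<K>(3) by (simp add: dense_subset_iff)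
qed

text \<open>
  A maximal disjoint family of open sets carrying a map with infinite images on all their nonempty open subsets is
  countable, and so is the set of isolated points; the maps combine into one. If the family and the isolated
  points left out an open set \<open>G\<close>, every map would have finite image, and hence be constant, on some
  nonempty open subset of \<open>G\<close>.
\<close>
lemma exists_rich_map:
  assumes X: "compact_space X" "Hausdorff_space X" and K: "dense_sets_k_separable X"
    and \<B>: "pi_base X \<B>" "\<B> \<lesssim> (UNIV :: real set)"
  shows "\<exists>f :: 'a \<Rightarrow> nat \<Rightarrow> real. continuous_map X euclidean f \<and>
     (\<forall>i x. openin X {i} \<longrightarrow> x \<in> topspace X \<longrightarrow> f x = f i \<longrightarrow> x = i) \<and>
     (\<forall>U. openin X U \<longrightarrow> U \<noteq> {} \<longrightarrow> no_isolated_points_in X U \<longrightarrow> infinite (f ` U))"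
proof -
  have ccc: "countable_cellularity X" using K by (rule k_separable_imp_countable_cellularity)
  define I where "I = {x. openin X {x}}"
  define rich where "rich V g \<longleftrightarrow> continuous_map X euclidean g \<and>
     (\<forall>U. openin X U \<longrightarrow> U \<noteq> {} \<longrightarrow> U \<subseteq> V \<longrightarrow> infinite (g ` U))" for V and g :: "'a \<Rightarrow> nat \<Rightarrow> real"
  define \<P> where "\<P> = {V. openin X V \<and> V \<noteq> {} \<and> (\<exists>g. rich V g)}"
  obtain \<V> where \<V>: "\<V> \<subseteq> \<P>" "disjoint \<V>" and max: "\<And>P. P \<in> \<P> \<Longrightarrow> P \<noteq> {} \<Longrightarrow> \<exists>U\<in>\<V>. P \<inter> U \<noteq> {}"
    using maximal_disjoint_subfamily[of \<P>] by metis
  have "\<forall>U\<in>\<V>. openin X U \<and> U \<noteq> {}" using \<V>(1) by (auto simp: \<P>_def)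
  then have cV: "countable \<V>" using \<V>(2) ccc unfolding countable_cellularity_def by blast
  have cI: "countable I"
  proof -
    have "disjoint ((\<lambda>x. {x}) ` I)" by (auto simp: disjoint_def)
    moreover have "\<forall>U\<in>(\<lambda>x. {x}) ` I. openin X U \<and> U \<noteq> {}" by (auto simp: I_def)
    ultimately have "countable ((\<lambda>x. {x}) ` I)" using ccc unfolding countable_cellularity_def by blast
    then show ?thesis by (rule countable_image_inj_on) simp
  qed
  define H where "H = \<Union>\<V> \<union> I"
  define G where "G = X exterior_of H"
  have IX: "I \<subseteq> topspace X" using openin_subset by (fastforce simp: I_def)
  have HX: "H \<subseteq> topspace X" using \<open>\<forall>U\<in>\<V>. openin X U \<and> U \<noteq> {}\<close> IX openin_subset by (fastforce simp: H_def)
  have HG: "H \<inter> G = {}" unfolding G_def by (rule exterior_of_disjoint[OF HX])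
  have Gempty: "G = {}"
  proof (rule ccontr)
    assume ne: "G \<noteq> {}"
    have op: "openin X G" by (simp add: G_def)
    have "G \<notin> \<P>" 
    proof
      assume "G \<in> \<P>"
      then obtain U where "U \<in> \<V>" "G \<inter> U \<noteq> {}" using max ne by blast
      then show False using HG by (auto simp: H_def)
    qed
    then have nr: "\<not> rich G g" for g using op ne by (auto simp: \<P>_def)
    have "all_maps_constant_somewhere X G"
      unfolding all_maps_constant_somewhere_def
    proof (intro allI impI)
      fix g :: "'a \<Rightarrow> nat \<Rightarrow> real" assume g: "continuous_map X euclidean g"
      then obtain U where U: "openin X U" "U \<noteq> {}" "U \<subseteq> G" "finite (g ` U)"
        using nr[of g] unfolding rich_def by blast
      from constant_on_open_of_finite_image[OF g U(1,2,4)] obtain W where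
        W: "openin X W" "W \<noteq> {}" "W \<subseteq> U" "\<forall>x\<in>W. \<forall>y\<in>W. g x = g y" by (elim exE conjE)
      show "\<exists>W. openin X W \<and> W \<noteq> {} \<and> W \<subseteq> G \<and> (\<forall>x\<in>W. \<forall>y\<in>W. g x = g y)"
        by (intro exI[of _ W] conjI W(1,2,4) subset_trans[OF W(3) U(3)])
    qed
    moreover have "no_isolated_points_in X G"
      using HG by (auto simp: no_isolated_points_in_def H_def I_def)
    ultimately show False using not_all_maps_constant_somewhere[OF X K \<B> op] by blast
  qed
  have "\<forall>V\<in>\<V>. \<exists>g. rich V g" using \<V>(1) by (auto simp: \<P>_def)
  from bchoice[OF this] obtain gV where gV: "\<forall>V\<in>\<V>. rich V (gV V)" by (elim exE)
  define ind where "ind i x (k::nat) = (if x = i then 1 else 0 :: real)" for i x :: 'a and k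
  define \<G> where "\<G> = gV ` \<V> \<union> ind ` I"
  have "countable \<G>" using cV cI by (simp add: \<G>_def)
  moreover have "continuous_map X euclidean g" if "g \<in> \<G>" for g
  proof -
    have "continuous_map X euclidean (ind i)" if i: "i \<in> I" for i
    proof -
      have op: "openin X {i}" using i by (simp add: I_def)
      have "closedin X {i}" using X(2) i IX
        by (metis Hausdorff_imp_t1_space closedin_t1_singleton subsetD)
      then have op2: "openin X (topspace X - {i})" by blast
      have "openin X {x \<in> topspace X. (if x = i then 1 else 0 :: real) \<in> T}" for T
      proof -
        have "i \<in> topspace X" using i IX by blast
        then have "{x \<in> topspace X. (if x = i then 1 else 0 :: real) \<in> T} =
          (if 1 \<in> T then {i} else {}) \<union> (if 0 \<in> T then topspace X - {i} else {})"
          by auto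
        also have "openin X \<dots>" using op op2 by (intro openin_Un) simp_all
        finally show ?thesis .
      qed
      then have "continuous_map X euclideanreal (\<lambda>x. if x = i then 1 else 0)"
        by (simp add: continuous_map_def)
      then show ?thesis by (simp add: continuous_map_into_sequences ind_def)
    qed
    then show ?thesis using that gV by (auto simp: \<G>_def rich_def)
  qed
  ultimately have "\<exists>f :: 'a \<Rightarrow> nat \<Rightarrow> real. continuous_map X euclidean f \<and>
     (\<forall>g\<in>\<G>. \<forall>x y. f x = f y \<longrightarrow> g x = g y)" by (rule combine_continuous_maps)
  then obtain f :: "'a \<Rightarrow> nat \<Rightarrow> real" where f: "continuous_map X euclidean f"
     "\<forall>g\<in>\<G>. \<forall>x y. f x = f y \<longrightarrow> g x = g y" by (elim exE conjE)
  have "x = i" if "openin X {i}" "f x = f i" for i x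
  proof -
    have "ind i \<in> \<G>" using that by (auto simp: \<G>_def I_def)
    then have "ind i x = ind i i" using f(2) that(2) by blast
    then have "ind i x 0 = ind i i 0" by simp
    then show ?thesis by (simp add: ind_def split: if_splits)
  qed
  moreover have "infinite (f ` U)" if U: "openin X U" "U \<noteq> {}" "no_isolated_points_in X U" for U
  proof -
    have "U \<inter> H \<noteq> {}"
    proof
      assume "U \<inter> H = {}"
      then have "U \<subseteq> G" unfolding G_def by (rule exterior_of_maximal[OF U(1)])
      then show False using Gempty U(2) by blast
    qed
    moreover have "U \<inter> I = {}" using U(3) by (auto simp: no_isolated_points_in_def I_def)
    ultimately obtain V where V: "V \<in> \<V>" "U \<inter> V \<noteq> {}" by (auto simp: H_def)
    have "openin X V" using V(1) \<V>(1) by (auto simp: \<P>_def)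
    then have "infinite (gV V ` (U \<inter> V))" using gV V U(1) by (auto simp: rich_def)
    moreover have "gV V x = gV V y" if "f x = f y" for x y
    proof -
      have "gV V \<in> \<G>" using V(1) by (simp add: \<G>_def)
      then show ?thesis using f(2) that by blast
    qed
    ultimately have "infinite (f ` (U \<inter> V))" by (rule infinite_image_factor)
    then show ?thesis using finite_subset[of "f ` (U \<inter> V)" "f ` U"] by blast
  qed
  ultimately show ?thesis using f(1) by (intro exI[of _ f]) simp
qed

lemma countable_pi_base_if_small_pi_base:
  assumes X: "compact_space X" "Hausdorff_space X" and K: "dense_sets_k_separable X"
    and \<B>: "pi_base X \<B>" "\<B> \<lesssim> (UNIV :: real set)"
  shows "\<exists>\<C>. countable \<C> \<and> pi_base X \<C>"
proof -
  from exists_rich_map[OF assms] obtain f :: "'a \<Rightarrow> nat \<Rightarrow> real" where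
    f: "continuous_map X euclidean f"
     "\<forall>i x. openin X {i} \<longrightarrow> x \<in> topspace X \<longrightarrow> f x = f i \<longrightarrow> x = i"
     "\<forall>U. openin X U \<longrightarrow> U \<noteq> {} \<longrightarrow> no_isolated_points_in X U \<longrightarrow> infinite (f ` U)" 
    by (elim exE conjE)
  show ?thesis
    by (rule countable_pi_base_of_rich_map[OF X K \<B> f(1)]) (use f(2,3) in simp_all)
qed

section \<open>Reflection in a small family of functions\<close>

text \<open>
  Terms over countably many operations of countable arity; their values form the closure of a single element under such
  operations. A term is determined by the labels of its nodes, which are reached by finite paths, so there are at
  most continuum many.
\<close>
datatype infinitary_term = Base | Apply nat "nat \<Rightarrow> infinitary_term"

primrec eval_term :: "(nat \<Rightarrow> (nat \<Rightarrow> 'b) \<Rightarrow> 'b) \<Rightarrow> 'b \<Rightarrow> infinitary_term \<Rightarrow> 'b" where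
  "eval_term op b Base = b"
| "eval_term op b (Apply k s) = op k (\<lambda>n. eval_term op b (s n))"

primrec term_labels :: "infinitary_term \<Rightarrow> nat list \<Rightarrow> nat option" where
  "term_labels Base = (\<lambda>_. None)"
| "term_labels (Apply k s) = (\<lambda>l. case l of [] \<Rightarrow> Some k | n # l' \<Rightarrow> term_labels (s n) l')"

lemma term_labels_inject: "term_labels t = term_labels t' \<Longrightarrow> t = t'"
proof (induction t arbitrary: t')
  case Base
  show ?case
  proof (cases t')
    case (Apply k s)
    then have "term_labels t' [] = Some k" by simp
    then show ?thesis using Base by (metis option.distinct(1) term_labels.simps(1))
  qed simp
next
  case (Apply k s)
  show ?case
  proof (cases t')
    case Base
    have "term_labels (Apply k s) [] = Some k" by simp
    then show ?thesis using Base Apply.prems by (metis option.distinct(1) term_labels.simps(1))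
  next
    case (Apply k' s')
    have "term_labels (Apply k s) [] = term_labels t' []" using Apply.prems by simp
    then have "k = k'" using \<open>t' = Apply k' s'\<close> by simp
    moreover have "s n = s' n" for n
    proof (rule Apply.IH)
      show "s n \<in> range s" by simp
      show "term_labels (s n) = term_labels (s' n)"
      proof
        fix l
        have "term_labels (Apply k s) (n # l) = term_labels t' (n # l)" using Apply.prems by simp
        then show "term_labels (s n) l = term_labels (s' n) l" using \<open>t' = Apply k' s'\<close> by simp
      qed
    qed
    ultimately show ?thesis using \<open>t' = Apply k' s'\<close> by auto
  qed
qed

lemma infinitary_terms_lepoll_continuum: "(UNIV :: infinitary_term set) \<lesssim> (UNIV :: real set)"
proof -
  define c where "c t = {to_nat (l, k) |l k. term_labels t l = Some k}" for t
  have "inj c"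
  proof (rule injI)
    fix t t' assume e: "c t = c t'"
    have *: "term_labels t l = Some k \<longleftrightarrow> to_nat (l, k) \<in> c t" for t l k
      by (auto simp: c_def)
    have "term_labels t l = Some k \<longleftrightarrow> term_labels t' l = Some k" for l k
      unfolding * e ..
    then have "term_labels t l = term_labels t' l" for l
      by (metis not_Some_eq)
    then show "t = t'" by (intro term_labels_inject) blast
  qed
  then have "(UNIV :: infinitary_term set) \<lesssim> (UNIV :: nat set set)" unfolding lepoll_def by blast
  then show ?thesis using nat_sets_eqpoll_reals lepoll_trans2 by blast
qed

lemma continuum_size_closure:
  fixes op :: "nat \<Rightarrow> (nat \<Rightarrow> 'b) \<Rightarrow> 'b"
  assumes b: "b \<in> C" and op: "\<And>k s. range s \<subseteq> C \<Longrightarrow> op k s \<in> C"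
  shows "\<exists>\<Phi>. b \<in> \<Phi> \<and> \<Phi> \<subseteq> C \<and> \<Phi> \<lesssim> (UNIV :: real set) \<and> (\<forall>k s. range s \<subseteq> \<Phi> \<longrightarrow> op k s \<in> \<Phi>)"
proof (intro exI conjI allI impI)
  let ?\<Phi> = "range (eval_term op b)"
  have "b = eval_term op b Base" by simp
  then show "b \<in> ?\<Phi>" by blast
  have "eval_term op b t \<in> C" for t
  proof (induction t)
    case (Apply k s)
    then have "range (\<lambda>n. eval_term op b (s n)) \<subseteq> C" by auto
    then show ?case using op by simp
  qed (simp add: b)
  then show "?\<Phi> \<subseteq> C" by blast
  show "?\<Phi> \<lesssim> (UNIV :: real set)"
    by (rule lepoll_trans[OF image_lepoll infinitary_terms_lepoll_continuum])
  fix k and s :: "nat \<Rightarrow> 'b" assume "range s \<subseteq> ?\<Phi>"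
  then have "\<forall>n. \<exists>t. s n = eval_term op b t" by blast
  from choice[OF this] obtain t where "\<forall>n. s n = eval_term op b (t n)" by (elim exE)
  then have "op k s = eval_term op b (Apply k t)" by (simp add: fun_eq_iff[symmetric])
  then show "op k s \<in> ?\<Phi>" by blast
qed

definition bump :: "real \<Rightarrow> real \<Rightarrow> real \<Rightarrow> real" where
  "bump p q t = max 0 (min (t - p) (q - t))"

lemma bump_nonzero: "bump p q t \<noteq> 0 \<longleftrightarrow> p < t \<and> t < q"
  by (auto simp: bump_def max_def min_def)

definition cozero_set :: "'a topology \<Rightarrow> ('a \<Rightarrow> real) \<Rightarrow> 'a set" where
  "cozero_set X \<phi> = {x \<in> topspace X. \<phi> x \<noteq> 0}"

lemma openin_cozero_set: "continuous_map X euclidean \<phi> \<Longrightarrow> openin X (cozero_set X \<phi>)"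
  using openin_continuous_map_preimage[of X euclidean \<phi> "- {0}"]
  by (simp add: cozero_set_def open_Compl)

text \<open>
  The two properties of functions that the small family has to reflect: \<open>avoids\<close> produces functions
  supported in the exterior of a union of countably many cozero sets, and \<open>unrefined_by\<close> detects that
  countably many cozero sets do not form a \<open>\<pi>\<close>-base.
\<close>
definition avoids :: "'a topology \<Rightarrow> ('a \<Rightarrow> real) set \<Rightarrow> ('a \<Rightarrow> real) \<Rightarrow> bool" where
  "avoids X \<S> \<phi> \<longleftrightarrow> (\<forall>\<psi>\<in>\<S>. cozero_set X \<psi> \<inter> cozero_set X \<phi> = {})"

definition unrefined_by :: "'a topology \<Rightarrow> ('a \<Rightarrow> real) set \<Rightarrow> ('a \<Rightarrow> real) \<Rightarrow> bool" where
  "unrefined_by X \<S> \<phi> \<longleftrightarrow> (\<forall>\<psi>\<in>\<S>. cozero_set X \<psi> \<noteq> {} \<longrightarrow> \<not> cozero_set X \<psi> \<subseteq> cozero_set X \<phi>)"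

text \<open>
  As in an elementary submodel: what some continuous function witnesses about countably many members of \<open>\<Phi>\<close>
  is witnessed inside \<open>\<Phi>\<close>.
\<close>
definition reflecting :: "'a topology \<Rightarrow> (('a \<Rightarrow> real) set \<Rightarrow> ('a \<Rightarrow> real) \<Rightarrow> bool) \<Rightarrow> ('a \<Rightarrow> real) set \<Rightarrow> bool" where
  "reflecting X P \<Phi> \<longleftrightarrow> (\<forall>\<S>\<subseteq>\<Phi>. countable \<S> \<longrightarrow>
     (\<exists>\<phi>. continuous_map X euclidean \<phi> \<and> cozero_set X \<phi> \<noteq> {} \<and> P \<S> \<phi>) \<longrightarrow>
     (\<exists>\<phi>\<in>\<Phi>. cozero_set X \<phi> \<noteq> {} \<and> P \<S> \<phi>))"

definition function_base :: "('a \<Rightarrow> real) set \<Rightarrow> bool" where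
  "function_base \<Phi> \<longleftrightarrow> (\<lambda>_. 1) \<in> \<Phi> \<and>
     (\<forall>\<phi>\<in>\<Phi>. \<forall>\<psi>\<in>\<Phi>. (\<lambda>x. \<phi> x * \<psi> x) \<in> \<Phi>) \<and>
     (\<forall>\<phi>\<in>\<Phi>. \<forall>p q. (\<lambda>x. bump (of_rat p) (of_rat q) (\<phi> x)) \<in> \<Phi>)"

text \<open>
  Closing off under multiplication, countably many bump functions, and a choice of witnesses for both
  properties.
\<close>
lemma exists_small_reflecting_function_base:
  fixes X :: "'a topology"
  shows "\<exists>\<Phi>. (\<forall>\<phi>\<in>\<Phi>. continuous_map X euclidean \<phi>) \<and> \<Phi> \<lesssim> (UNIV :: real set) \<and>
     function_base \<Phi> \<and> reflecting X (avoids X) \<Phi> \<and> reflecting X (unrefined_by X) \<Phi>"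
proof -
  define C where "C = {\<phi> :: 'a \<Rightarrow> real. continuous_map X euclidean \<phi>}"
  define good where "good P s \<phi> \<longleftrightarrow> \<phi> \<in> C \<and> cozero_set X \<phi> \<noteq> {} \<and> P (range s) \<phi>"
    for P and s :: "nat \<Rightarrow> 'a \<Rightarrow> real" and \<phi> :: "'a \<Rightarrow> real"
  define pick where "pick P s = (if \<exists>\<phi>. good P s \<phi> then SOME \<phi>. good P s \<phi> else (\<lambda>_. 1))" for P s
  have pick: "good P s (pick P s)" if "\<exists>\<phi>. good P s \<phi>" for P s
    using someI_ex[OF that] that by (simp add: pick_def)
  have one: "(\<lambda>_. 1) \<in> C" by (simp add: C_def)
  have pickC: "pick P s \<in> C" for P s
    using pick[of P s] one by (cases "\<exists>\<phi>. good P s \<phi>") (auto simp: good_def pick_def)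
  \<comment> \<open>Operation number \<open>n + 3\<close> is the bump function for the \<open>n\<close>-th pair of rational numbers.\<close>
  define op where "op k s = (if k = 0 then (\<lambda>x. s 0 x * s 1 x)
      else if k = 1 then pick (avoids X) s else if k = 2 then pick (unrefined_by X) s
      else (let (p, q) = from_nat (k - 3) in (\<lambda>x. bump (of_rat p) (of_rat q) (s 0 x))))"
    for k :: nat and s :: "nat \<Rightarrow> 'a \<Rightarrow> real"
  have opC: "op k s \<in> C" if s: "range s \<subseteq> C" for k s
  proof -
    have sn: "continuous_map X euclidean (s n)" for n using s by (auto simp: C_def)
    have "(\<lambda>x. s 0 x * s 1 x) \<in> C" using continuous_map_real_mult[OF sn sn] by (simp add: C_def)
    moreover have "(\<lambda>x. bump p q (s 0 x)) \<in> C" for p q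
      unfolding C_def bump_def mem_Collect_eq by (intro continuous_intros sn)
    ultimately show ?thesis using pickC by (auto simp: op_def split: prod.splits)
  qed
  have "\<exists>\<Phi>. (\<lambda>_. 1) \<in> \<Phi> \<and> \<Phi> \<subseteq> C \<and> \<Phi> \<lesssim> (UNIV :: real set) \<and>
      (\<forall>k s. range s \<subseteq> \<Phi> \<longrightarrow> op k s \<in> \<Phi>)"
    by (rule continuum_size_closure[OF one]) (rule opC)
  then obtain \<Phi> where
    \<Phi>: "(\<lambda>_. 1) \<in> \<Phi>" "\<Phi> \<subseteq> C" "\<Phi> \<lesssim> (UNIV :: real set)" "\<forall>k s. range s \<subseteq> \<Phi> \<longrightarrow> op k s \<in> \<Phi>"
    by (elim exE conjE)
  have cl: "op k s \<in> \<Phi>" if "range s \<subseteq> \<Phi>" for k s using \<Phi>(4) that by blast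
  have "function_base \<Phi>"
    unfolding function_base_def
  proof (intro conjI ballI allI)
    fix \<phi> \<psi> assume "\<phi> \<in> \<Phi>" "\<psi> \<in> \<Phi>"
    then have "op 0 (\<lambda>n. if n = 0 then \<phi> else \<psi>) \<in> \<Phi>" by (intro cl) auto
    then show "(\<lambda>x. \<phi> x * \<psi> x) \<in> \<Phi>" by (simp add: op_def)
  next
    fix \<phi> and p q :: rat assume "\<phi> \<in> \<Phi>"
    then have "op (to_nat (p, q) + 3) (\<lambda>n. \<phi>) \<in> \<Phi>" by (intro cl) auto
    then show "(\<lambda>x. bump (of_rat p) (of_rat q) (\<phi> x)) \<in> \<Phi>" by (simp add: op_def)
  qed (rule \<Phi>(1))
  moreover have refl: "reflecting X P \<Phi>" if k: "\<And>s. pick P s = op k s" 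
    and P: "P {} = P {\<lambda>_. 0}" for P k
    unfolding reflecting_def
  proof (intro allI impI)
    fix \<S> assume S: "\<S> \<subseteq> \<Phi>" "countable \<S>" 
      and ex: "\<exists>\<phi>. continuous_map X euclidean \<phi> \<and> cozero_set X \<phi> \<noteq> {} \<and> P \<S> \<phi>"
    \<comment> \<open>The operations take sequences, so an empty \<open>\<S>\<close> is replaced by the zero function, which is a bump
      with reversed end points.\<close>
    have zero: "(\<lambda>_. 0) \<in> \<Phi>"
    proof -
      have "op (to_nat (2::rat, 0::rat) + 3) (\<lambda>n _. 1) \<in> \<Phi>" using \<Phi>(1) by (intro cl) auto
      then show ?thesis by (simp add: op_def bump_def)
    qed
    define \<S>' where "\<S>' = (if \<S> = {} then {\<lambda>_. 0} else \<S>)"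
    define s where "s = from_nat_into \<S>'"
    have "\<S>' \<noteq> {}" "countable \<S>'" using S(2) by (auto simp: \<S>'_def)
    then have rs: "range s = \<S>'" unfolding s_def by (rule range_from_nat_into)
    have PS: "P \<S>' = P \<S>" using P by (simp add: \<S>'_def)
    have "\<exists>\<phi>. good P s \<phi>" using ex unfolding good_def rs PS C_def by simp
    then have "good P s (pick P s)" by (rule pick)
    then have "good P s (op k s)" unfolding k .
    moreover have "op k s \<in> \<Phi>" using rs S(1) zero by (intro cl) (auto simp: \<S>'_def split: if_splits)
    ultimately show "\<exists>\<phi>\<in>\<Phi>. cozero_set X \<phi> \<noteq> {} \<and> P \<S> \<phi>"
      unfolding good_def rs PS by blast
  qed
  have "reflecting X (avoids X) \<Phi>"
    by (rule refl[of _ 1]) (auto simp: op_def avoids_def cozero_set_def fun_eq_iff)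
  moreover have "reflecting X (unrefined_by X) \<Phi>"
    by (rule refl[of _ 2]) (auto simp: op_def unrefined_by_def cozero_set_def fun_eq_iff)
  ultimately show ?thesis using \<Phi>(2,3) unfolding C_def by (intro exI[of _ \<Phi>]) auto
qed

definition evaluation :: "('a \<Rightarrow> real) set \<Rightarrow> 'a \<Rightarrow> ('a \<Rightarrow> real) \<Rightarrow> real" where
  "evaluation \<Phi> x = (\<lambda>\<phi>\<in>\<Phi>. \<phi> x)"

section \<open>Reduction to spaces with a small \<open>\<pi>\<close>-base\<close>
definition function_quotient :: "'a topology \<Rightarrow> ('a \<Rightarrow> real) set \<Rightarrow> (('a \<Rightarrow> real) \<Rightarrow> real) topology" where
  "function_quotient X \<Phi> = subtopology (product_topology (\<lambda>_. euclidean) \<Phi>) (evaluation \<Phi> ` topspace X)"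

context
  fixes X :: "'a topology" and \<Phi> :: "('a \<Rightarrow> real) set"
  assumes cont: "\<forall>\<phi>\<in>\<Phi>. continuous_map X euclidean \<phi>"
begin

lemma topspace_function_quotient: "topspace (function_quotient X \<Phi>) = evaluation \<Phi> ` topspace X"
  by (auto simp: function_quotient_def evaluation_def)

lemma continuous_map_evaluation: "continuous_map X (function_quotient X \<Phi>) (evaluation \<Phi>)"
  unfolding function_quotient_def continuous_map_in_subtopology continuous_map_componentwise
  using cont by (auto simp: evaluation_def)

lemma Hausdorff_function_quotient: "Hausdorff_space (function_quotient X \<Phi>)"
  unfolding function_quotient_def
  by (intro Hausdorff_space_subtopology) (simp add: Hausdorff_space_product_topology)

lemma compact_function_quotient: "compact_space X \<Longrightarrow> compact_space (function_quotient X \<Phi>)"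
  using image_compactin[OF _ continuous_map_evaluation, of "topspace X"]
  by (simp add: compact_space_def topspace_function_quotient)

lemma openin_function_quotient_coordinate:
  assumes "\<phi> \<in> \<Phi>" shows "openin (function_quotient X \<Phi>) {z \<in> topspace (function_quotient X \<Phi>). z \<phi> \<noteq> 0}"
proof -
  have "continuous_map (function_quotient X \<Phi>) euclideanreal (\<lambda>z. z \<phi>)"
    unfolding function_quotient_def
    by (intro continuous_map_from_subtopology continuous_map_product_projection assms)
  from openin_cozero_set[OF this] show ?thesis by (simp add: cozero_set_def)
qed

text \<open>
  The cozero sets of members of \<open>\<Phi>\<close> form a base of the quotient: bump functions localize one coordinate in an
  interval with rational end points, and products give finite intersections.
\<close>
lemma function_base_neighbourhood:
  assumes \<Phi>: "function_base \<Phi>" and W: "openin (function_quotient X \<Phi>) W" 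
    and x: "x \<in> topspace X" "evaluation \<Phi> x \<in> W"
  shows "\<exists>\<psi>\<in>\<Phi>. \<psi> x \<noteq> 0 \<and> (\<forall>y\<in>topspace X. \<psi> y \<noteq> 0 \<longrightarrow> evaluation \<Phi> y \<in> W)"
proof -
  have step: "\<exists>\<psi>\<in>\<Phi>. \<psi> x \<noteq> 0 \<and> (\<forall>y. \<psi> y \<noteq> 0 \<longrightarrow> \<phi> y \<in> T)" if "\<phi> \<in> \<Phi>" "open T" "\<phi> x \<in> T" for \<phi> T
  proof -
    obtain e where e: "e > 0" "ball (\<phi> x) e \<subseteq> T" using \<open>open T\<close> \<open>\<phi> x \<in> T\<close> openE by blast
    obtain p where p: "\<phi> x - e < of_rat p" "of_rat p < \<phi> x" using of_rat_dense[of "\<phi> x - e" "\<phi> x"] e by auto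
    obtain q where q: "\<phi> x < of_rat q" "of_rat q < \<phi> x + e" using of_rat_dense[of "\<phi> x" "\<phi> x + e"] e by auto
    have "(\<lambda>x. bump (of_rat p) (of_rat q) (\<phi> x)) \<in> \<Phi>" using \<Phi> that(1) by (simp add: function_base_def)
    moreover have "\<phi> y \<in> T" if "of_rat p < \<phi> y" "\<phi> y < of_rat q" for y
      using that p q e(2) by (intro subsetD[OF e(2)]) (auto simp: dist_real_def)
    ultimately show ?thesis using p q
      by (intro bexI[of _ "\<lambda>x. bump (of_rat p) (of_rat q) (\<phi> x)"]) (auto simp: bump_nonzero)
  qed
  obtain W' where W': "openin (product_topology (\<lambda>_. euclidean) \<Phi>) W'" 
      "W = W' \<inter> evaluation \<Phi> ` topspace X"
    using W by (auto simp: function_quotient_def openin_subtopology)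
  have "evaluation \<Phi> x \<in> W'" using x(2) W'(2) by blast
  then obtain U where U: "finite {\<phi> \<in> \<Phi>. U \<phi> \<noteq> (UNIV :: real set)}" "\<forall>\<phi>\<in>\<Phi>. open (U \<phi>)" 
      "evaluation \<Phi> x \<in> Pi\<^sub>E \<Phi> U" "Pi\<^sub>E \<Phi> U \<subseteq> W'"
    using W'(1) unfolding openin_product_topology_alt by auto
  have "\<exists>\<psi>\<in>\<Phi>. \<psi> x \<noteq> 0 \<and> (\<forall>y. \<psi> y \<noteq> 0 \<longrightarrow> (\<forall>\<phi>\<in>J. \<phi> y \<in> U \<phi>))"
    if "finite J" "J \<subseteq> \<Phi>" for J
    using that
  proof (induction J)
    case empty
    have "(\<lambda>_. 1) \<in> \<Phi>" using \<Phi> by (simp add: function_base_def)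
    then show ?case by (intro bexI[of _ "\<lambda>_. 1"]) auto
  next
    case (insert \<phi> J)
    then have "\<phi> \<in> \<Phi>" "J \<subseteq> \<Phi>" by auto
    from insert.IH[OF this(2)] obtain \<psi> where \<psi>: "\<psi> \<in> \<Phi>" "\<psi> x \<noteq> 0" "\<forall>y. \<psi> y \<noteq> 0 \<longrightarrow> (\<forall>\<phi>\<in>J. \<phi> y \<in> U \<phi>)"
      by (elim bexE conjE)
    have "\<phi> x \<in> U \<phi>" using U(3) \<open>\<phi> \<in> \<Phi>\<close> by (auto simp: evaluation_def)
    from step[OF \<open>\<phi> \<in> \<Phi>\<close> _ this] U(2) \<open>\<phi> \<in> \<Phi>\<close>
    obtain \<theta> where \<theta>: "\<theta> \<in> \<Phi>" "\<theta> x \<noteq> 0" "\<forall>y. \<theta> y \<noteq> 0 \<longrightarrow> \<phi> y \<in> U \<phi>" by auto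
    have "(\<lambda>y. \<theta> y * \<psi> y) \<in> \<Phi>" using \<Phi> \<psi>(1) \<theta>(1) by (simp add: function_base_def)
    then show ?case using \<psi>(2,3) \<theta>(2,3) by (intro bexI[of _ "\<lambda>y. \<theta> y * \<psi> y"]) auto
  qed
  from this[OF U(1)] obtain \<psi> where \<psi>: "\<psi> \<in> \<Phi>" "\<psi> x \<noteq> 0" 
    "\<forall>y. \<psi> y \<noteq> 0 \<longrightarrow> (\<forall>\<phi>\<in>{\<phi> \<in> \<Phi>. U \<phi> \<noteq> UNIV}. \<phi> y \<in> U \<phi>)" by auto
  have "evaluation \<Phi> y \<in> W" if y: "y \<in> topspace X" "\<psi> y \<noteq> 0" for y
  proof -
    have "\<phi> y \<in> U \<phi>" if "\<phi> \<in> \<Phi>" for \<phi>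
      using \<psi>(3) y(2) that by (cases "U \<phi> = UNIV") auto
    then have "evaluation \<Phi> y \<in> Pi\<^sub>E \<Phi> U" by (auto simp: evaluation_def)
    then show ?thesis using U(4) W'(2) y(1) by blast
  qed
  then show ?thesis using \<psi>(1,2) by blast
qed

text \<open>
  Shrink \<open>U\<close> to \<open>V\<close> and take a maximal disjoint family of cozero sets from \<open>\<Phi>\<close> that miss \<open>V\<close>. It is
  countable, and \<open>V\<close> shows that its union is not dense, so by reflection some cozero set of a member \<open>\<phi>\<close> of \<open>\<Phi>\<close>
  is disjoint from the family. If a point of this cozero set were not identified with a point of the
  closure of \<open>V\<close>, a smaller cozero set from \<open>\<Phi>\<close> around it would miss \<open>V\<close> and contradict maximality.
\<close>
lemma evaluation_quasi_open:
  assumes X: "compact_space X" "Hausdorff_space X" and ccc: "countable_cellularity X"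
    and \<Phi>: "function_base \<Phi>" and refl: "reflecting X (avoids X) \<Phi>"
    and U: "openin X U" "U \<noteq> {}"
  shows "\<exists>\<phi>\<in>\<Phi>. cozero_set X \<phi> \<noteq> {} \<and> evaluation \<Phi> ` cozero_set X \<phi> \<subseteq> evaluation \<Phi> ` U"
proof -
  let ?Z = "function_quotient X \<Phi>"
  obtain u where u: "u \<in> U" using U(2) by blast
  obtain V where V: "openin X V" "u \<in> V" "X closure_of V \<subseteq> U"
    using compact_Hausdorff_open_shrink[OF X U(1) u] .
  have VV: "V \<subseteq> X closure_of V" by (rule closure_of_subset[OF openin_subset[OF V(1)]])
  define \<P> where "\<P> = {cozero_set X \<phi> |\<phi>. \<phi> \<in> \<Phi> \<and> cozero_set X \<phi> \<noteq> {} \<and> cozero_set X \<phi> \<inter> V = {}}"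
  obtain \<D> where \<D>: "\<D> \<subseteq> \<P>" "disjoint \<D>" and max: "\<And>P. P \<in> \<P> \<Longrightarrow> P \<noteq> {} \<Longrightarrow> \<exists>D\<in>\<D>. P \<inter> D \<noteq> {}"
    using maximal_disjoint_subfamily[of \<P>] by metis
  have D: "\<exists>\<phi>. D = cozero_set X \<phi> \<and> \<phi> \<in> \<Phi> \<and> cozero_set X \<phi> \<noteq> {} \<and> cozero_set X \<phi> \<inter> V = {}"
    if "D \<in> \<D>" for D
    using subsetD[OF \<D>(1) that] unfolding \<P>_def by (rule CollectD)
  have "\<forall>D\<in>\<D>. openin X D \<and> D \<noteq> {}"
  proof
    fix D assume "D \<in> \<D>"
    from D[OF this] obtain \<phi> where "D = cozero_set X \<phi>" "\<phi> \<in> \<Phi>" "cozero_set X \<phi> \<noteq> {}" by (elim exE conjE)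
    then show "openin X D \<and> D \<noteq> {}" using openin_cozero_set[of X \<phi>] cont by simp
  qed
  then have cD: "countable \<D>" using \<D>(2) ccc unfolding countable_cellularity_def by blast
  have "\<forall>D\<in>\<D>. \<exists>\<phi>. \<phi> \<in> \<Phi> \<and> cozero_set X \<phi> = D \<and> D \<inter> V = {}"
  proof
    fix D assume "D \<in> \<D>"
    from D[OF this] show "\<exists>\<phi>. \<phi> \<in> \<Phi> \<and> cozero_set X \<phi> = D \<and> D \<inter> V = {}" by auto
  qed
  from bchoice[OF this] obtain f where f: "\<forall>D\<in>\<D>. f D \<in> \<Phi> \<and> cozero_set X (f D) = D \<and> D \<inter> V = {}"
    by (elim exE)
  from compact_Hausdorff_cozero[OF X V(1,2)] obtain \<phi>0 where \<phi>0: "continuous_map X euclideanreal \<phi>0"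
    "\<phi>0 u = 1" "{z \<in> topspace X. \<phi>0 z \<noteq> 0} \<subseteq> V" by (elim exE conjE)
  have "u \<in> topspace X" using V openin_subset by blast
  then have "u \<in> cozero_set X \<phi>0" using \<phi>0(2) by (simp add: cozero_set_def)
  then have "cozero_set X \<phi>0 \<noteq> {}" by blast
  moreover have "avoids X (f ` \<D>) \<phi>0"
    unfolding avoids_def
  proof
    fix \<psi> assume "\<psi> \<in> f ` \<D>"
    then have "cozero_set X \<psi> \<inter> V = {}" using f by auto
    then show "cozero_set X \<psi> \<inter> cozero_set X \<phi>0 = {}" using \<phi>0(3) by (auto simp: cozero_set_def)
  qed
  moreover have "f ` \<D> \<subseteq> \<Phi>" "countable (f ` \<D>)" using f cD by auto
  ultimately have "\<exists>\<phi>\<in>\<Phi>. cozero_set X \<phi> \<noteq> {} \<and> avoids X (f ` \<D>) \<phi>"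
    using refl \<phi>0(1) unfolding reflecting_def by blast
  then obtain \<phi> where \<phi>: "\<phi> \<in> \<Phi>" "cozero_set X \<phi> \<noteq> {}" "avoids X (f ` \<D>) \<phi>" by (elim bexE conjE)
  have "evaluation \<Phi> x \<in> evaluation \<Phi> ` (X closure_of V)" if x: "x \<in> cozero_set X \<phi>" for x
  proof (rule ccontr)
    assume nin: "\<not> ?thesis"
    have xX: "x \<in> topspace X" using x by (simp add: cozero_set_def)
    have "compactin ?Z (evaluation \<Phi> ` (X closure_of V))"
      using X(1) by (intro image_compactin[OF _ continuous_map_evaluation] closedin_compact_space) auto
    then have "closedin ?Z (evaluation \<Phi> ` (X closure_of V))"
      by (rule compactin_imp_closedin[OF Hausdorff_function_quotient])
    then have "openin ?Z (topspace ?Z - evaluation \<Phi> ` (X closure_of V))" by blast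
    moreover have "evaluation \<Phi> x \<in> topspace ?Z - evaluation \<Phi> ` (X closure_of V)"
      using nin xX by (simp add: topspace_function_quotient)
    ultimately have "\<exists>\<psi>\<in>\<Phi>. \<psi> x \<noteq> 0 \<and> (\<forall>y\<in>topspace X. \<psi> y \<noteq> 0 \<longrightarrow>
        evaluation \<Phi> y \<in> topspace ?Z - evaluation \<Phi> ` (X closure_of V))"
      by (rule function_base_neighbourhood[OF \<Phi> _ xX])
    then obtain \<psi> where \<psi>: "\<psi> \<in> \<Phi>" "\<psi> x \<noteq> 0" 
      "\<forall>y\<in>topspace X. \<psi> y \<noteq> 0 \<longrightarrow> evaluation \<Phi> y \<in> topspace ?Z - evaluation \<Phi> ` (X closure_of V)"
      by (elim bexE conjE)
    define \<theta> where "\<theta> = (\<lambda>y. \<psi> y * \<phi> y)"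
    have \<theta>: "\<theta> \<in> \<Phi>" using \<Phi> \<psi>(1) \<phi>(1) by (simp add: function_base_def \<theta>_def)
    have sub: "cozero_set X \<theta> \<subseteq> cozero_set X \<phi>" by (auto simp: cozero_set_def \<theta>_def)
    have "x \<in> cozero_set X \<theta>" using x \<psi>(2) by (simp add: cozero_set_def \<theta>_def)
    moreover have "cozero_set X \<theta> \<inter> V = {}"
      using \<psi>(3) VV by (auto simp: cozero_set_def \<theta>_def)
    ultimately have "cozero_set X \<theta> \<in> \<P>" "cozero_set X \<theta> \<noteq> {}" using \<theta> by (auto simp: \<P>_def)
    then obtain D where D: "D \<in> \<D>" "cozero_set X \<theta> \<inter> D \<noteq> {}" using max by blast
    then have "cozero_set X (f D) \<inter> cozero_set X \<phi> = {}" using \<phi>(3) by (simp add: avoids_def)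
    moreover have "cozero_set X (f D) = D" using f D(1) by blast
    ultimately show False using D(2) sub by blast
  qed
  then have "evaluation \<Phi> ` cozero_set X \<phi> \<subseteq> evaluation \<Phi> ` (X closure_of V)" by blast
  also have "\<dots> \<subseteq> evaluation \<Phi> ` U" using V(3) by (rule image_mono)
  finally show ?thesis using \<phi>(1,2) by (intro bexI[of _ \<phi>] conjI)
qed

text \<open>
  As images of nonempty open sets have nonempty interior, the preimage of a dense set is dense; the compact sets found
  in it are mapped to the quotient.
\<close>
lemma function_quotient_k_separable:
  assumes X: "compact_space X" "Hausdorff_space X" and K: "dense_sets_k_separable X"
    and \<Phi>: "function_base \<Phi>" and refl: "reflecting X (avoids X) \<Phi>"
  shows "dense_sets_k_separable (function_quotient X \<Phi>)"
  unfolding dense_sets_k_separable_def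
proof (intro allI impI)
  let ?Z = "function_quotient X \<Phi>"
  have ccc: "countable_cellularity X" using K by (rule k_separable_imp_countable_cellularity)
  fix Y assume Y: "dense_subset ?Z Y"
  define P where "P = {x \<in> topspace X. evaluation \<Phi> x \<in> Y}"
  have "dense_subset X P"
    unfolding dense_subset_iff
  proof (intro conjI allI impI)
    show "P \<subseteq> topspace X" by (auto simp: P_def)
    fix U assume U: "openin X U" "U \<noteq> {}"
    from evaluation_quasi_open[OF X ccc \<Phi> refl U] obtain \<phi> where
      \<phi>: "\<phi> \<in> \<Phi>" "cozero_set X \<phi> \<noteq> {}" "evaluation \<Phi> ` cozero_set X \<phi> \<subseteq> evaluation \<Phi> ` U" 
      by (elim bexE conjE)
    let ?W = "{z \<in> topspace ?Z. z \<phi> \<noteq> 0}"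
    have Weq: "?W = evaluation \<Phi> ` cozero_set X \<phi>"
      using \<phi>(1) by (auto simp: topspace_function_quotient cozero_set_def evaluation_def)
    have "openin ?Z ?W" by (rule openin_function_quotient_coordinate[OF \<phi>(1)])
    moreover have "?W \<noteq> {}" using \<phi>(2) unfolding Weq by blast
    ultimately have "?W \<inter> Y \<noteq> {}" using Y unfolding dense_subset_iff by blast
    then obtain z where "z \<in> Y" "z \<in> evaluation \<Phi> ` U" using \<phi>(3) unfolding Weq by blast
    then show "U \<inter> P \<noteq> {}" using openin_subset[OF U(1)] by (auto simp: P_def)
  qed
  then obtain \<K> where \<K>: "countable \<K>" "\<And>K. K \<in> \<K> \<Longrightarrow> compactin X K \<and> K \<subseteq> P"
     "dense_subset X (\<Union>\<K>)"
    using K unfolding dense_sets_k_separable_def by metis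
  show "\<exists>\<L>. countable \<L> \<and> (\<forall>L\<in>\<L>. compactin ?Z L \<and> L \<subseteq> Y) \<and> dense_subset ?Z (\<Union>\<L>)"
  proof (intro exI[of _ "(\<lambda>K. evaluation \<Phi> ` K) ` \<K>"] conjI ballI)
    show "countable ((\<lambda>K. evaluation \<Phi> ` K) ` \<K>)" using \<K>(1) by simp
    fix L assume "L \<in> (\<lambda>K. evaluation \<Phi> ` K) ` \<K>"
    then obtain K where KL: "K \<in> \<K>" "L = evaluation \<Phi> ` K" by blast
    show "compactin ?Z L" unfolding KL(2)
      using \<K>(2)[OF KL(1)] by (intro image_compactin[OF _ continuous_map_evaluation]) simp
    show "L \<subseteq> Y" unfolding KL(2) using \<K>(2)[OF KL(1)] by (auto simp: P_def)
  next
    show "dense_subset ?Z (\<Union>((\<lambda>K. evaluation \<Phi> ` K) ` \<K>))"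
      unfolding dense_subset_iff
    proof (intro conjI allI impI)
      have "\<Union>\<K> \<subseteq> topspace X" using \<K>(3) by (simp add: dense_subset_iff)
      then show "\<Union>((\<lambda>K. evaluation \<Phi> ` K) ` \<K>) \<subseteq> topspace ?Z" 
        by (auto simp: topspace_function_quotient)
      fix W assume W: "openin ?Z W" "W \<noteq> {}"
      define U where "U = {x \<in> topspace X. evaluation \<Phi> x \<in> W}"
      have "openin X U" unfolding U_def by (rule openin_continuous_map_preimage[OF continuous_map_evaluation W(1)])
      moreover have "U \<noteq> {}"
      proof -
        obtain w where "w \<in> W" using W(2) by blast
        moreover then have "w \<in> evaluation \<Phi> ` topspace X"
          using openin_subset[OF W(1)] by (auto simp: topspace_function_quotient)
        ultimately show ?thesis by (auto simp: U_def)
      qed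
      ultimately have "U \<inter> \<Union>\<K> \<noteq> {}" using \<K>(3) by (simp add: dense_subset_iff)
      then obtain x K where "K \<in> \<K>" "x \<in> K" "x \<in> U" by auto
      then show "W \<inter> \<Union>((\<lambda>K. evaluation \<Phi> ` K) ` \<K>) \<noteq> {}" by (auto simp: U_def)
    qed
  qed
qed

end

text \<open>
  A countable \<open>\<pi>\<close>-base of the quotient can be taken to consist of cozero sets of members of \<open>\<Phi>\<close>. If some open set of
  \<open>X\<close> contained none of the corresponding cozero sets in \<open>X\<close>, reflection of \<open>unrefined_by\<close> would produce a cozero set
  of a member of \<open>\<Phi>\<close> with the same property, which contradicts the \<open>\<pi>\<close>-base property in the quotient.
\<close>
lemma k_separable_imp_countable_pi_base:
  fixes X :: "'a topology"
  assumes X: "compact_space X" "Hausdorff_space X" and K: "dense_sets_k_separable X"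
  shows "\<exists>\<C>. countable \<C> \<and> pi_base X \<C>"
proof -
  from exists_small_reflecting_function_base[of X] obtain \<Phi> where
    cont: "\<forall>\<phi>\<in>\<Phi>. continuous_map X euclidean \<phi>" and small: "\<Phi> \<lesssim> (UNIV :: real set)" and
    \<Phi>: "function_base \<Phi>" and refl: "reflecting X (avoids X) \<Phi>" "reflecting X (unrefined_by X) \<Phi>"
    by (elim exE conjE)
  let ?Z = "function_quotient X \<Phi>"
  define N where "N \<phi> = {z \<in> topspace ?Z. z \<phi> \<noteq> 0}" for \<phi> :: "'a \<Rightarrow> real"
  have N: "N \<phi> = evaluation \<Phi> ` cozero_set X \<phi>" if "\<phi> \<in> \<Phi>" for \<phi>
    using that by (auto simp: N_def topspace_function_quotient[OF cont] cozero_set_def evaluation_def)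
  have Nop: "openin ?Z (N \<phi>)" if "\<phi> \<in> \<Phi>" for \<phi>
    unfolding N_def by (rule openin_function_quotient_coordinate[OF cont that])
  have Nbase: "\<exists>\<phi>\<in>\<Phi>. N \<phi> \<noteq> {} \<and> N \<phi> \<subseteq> W" if W: "openin ?Z W" "W \<noteq> {}" for W
  proof -
    obtain w where "w \<in> W" using W(2) by blast
    moreover have "W \<subseteq> evaluation \<Phi> ` topspace X"
      using openin_subset[OF W(1)] by (simp add: topspace_function_quotient[OF cont])
    ultimately obtain x where x: "x \<in> topspace X" "evaluation \<Phi> x \<in> W" by blast
    from function_base_neighbourhood[OF cont \<Phi> W(1) x] obtain \<psi> where
      \<psi>: "\<psi> \<in> \<Phi>" "\<psi> x \<noteq> 0" "\<forall>y\<in>topspace X. \<psi> y \<noteq> 0 \<longrightarrow> evaluation \<Phi> y \<in> W" by (elim bexE conjE)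
    have "x \<in> cozero_set X \<psi>" using x \<psi>(2) by (simp add: cozero_set_def)
    then have "N \<psi> \<noteq> {}" unfolding N[OF \<psi>(1)] by blast
    moreover have "N \<psi> \<subseteq> W" unfolding N[OF \<psi>(1)] using \<psi>(3) by (auto simp: cozero_set_def)
    ultimately show ?thesis using \<psi>(1) by (intro bexI[of _ \<psi>] conjI)
  qed
  define \<B> where "\<B> = N ` \<Phi> - {{}}"
  have "pi_base ?Z \<B>" unfolding pi_base_def
  proof (intro conjI ballI allI impI)
    fix B assume "B \<in> \<B>"
    then show "openin ?Z B" "B \<noteq> {}" using Nop by (auto simp: \<B>_def)
  next
    fix W assume "openin ?Z W \<and> W \<noteq> {}"
    then have "\<exists>\<phi>\<in>\<Phi>. N \<phi> \<noteq> {} \<and> N \<phi> \<subseteq> W" using Nbase by simp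
    then show "\<exists>B\<in>\<B>. B \<subseteq> W" by (auto simp: \<B>_def)
  qed
  moreover have "\<B> \<lesssim> (UNIV :: real set)"
    unfolding \<B>_def by (rule lepoll_trans[OF subset_imp_lepoll lepoll_trans[OF image_lepoll small]]) blast
  ultimately have "\<exists>\<C>. countable \<C> \<and> pi_base ?Z \<C>"
    by (intro countable_pi_base_if_small_pi_base[OF compact_function_quotient[OF cont X(1)]
       Hausdorff_function_quotient[OF cont] function_quotient_k_separable[OF cont X K \<Phi> refl(1)]])
  then obtain \<C> where \<C>: "countable \<C>" "pi_base ?Z \<C>" by (elim exE conjE)
  have "\<forall>C\<in>\<C>. \<exists>\<phi>. \<phi> \<in> \<Phi> \<and> N \<phi> \<noteq> {} \<and> N \<phi> \<subseteq> C"
  proof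
    fix C assume "C \<in> \<C>"
    then have "openin ?Z C" "C \<noteq> {}" using \<C>(2) by (simp_all add: pi_base_def)
    then show "\<exists>\<phi>. \<phi> \<in> \<Phi> \<and> N \<phi> \<noteq> {} \<and> N \<phi> \<subseteq> C" using Nbase[of C] by blast
  qed
  from bchoice[OF this] obtain f where f: "\<forall>C\<in>\<C>. f C \<in> \<Phi> \<and> N (f C) \<noteq> {} \<and> N (f C) \<subseteq> C" by (elim exE)
  have fne: "cozero_set X (f C) \<noteq> {}" if "C \<in> \<C>" for C
  proof -
    have "f C \<in> \<Phi>" "N (f C) \<noteq> {}" using f that by blast+
    then show ?thesis using N by auto
  qed
  have "\<exists>C\<in>\<C>. cozero_set X (f C) \<subseteq> U" if U: "openin X U" "U \<noteq> {}" for U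
  proof (rule ccontr)
    assume neg: "\<not> ?thesis"
    obtain u where u: "u \<in> U" using U(2) by blast
    from compact_Hausdorff_cozero[OF X U(1) u] obtain \<phi>0 where \<phi>0: "continuous_map X euclideanreal \<phi>0"
      "\<phi>0 u = 1" "{z \<in> topspace X. \<phi>0 z \<noteq> 0} \<subseteq> U" by (elim exE conjE)
    have "u \<in> topspace X" using u openin_subset[OF U(1)] by blast
    then have "u \<in> cozero_set X \<phi>0" using \<phi>0(2) by (simp add: cozero_set_def)
    then have ne: "cozero_set X \<phi>0 \<noteq> {}" by blast
    have sub: "cozero_set X \<phi>0 \<subseteq> U" using \<phi>0(3) by (simp add: cozero_set_def)
    have "unrefined_by X (f ` \<C>) \<phi>0"
      unfolding unrefined_by_def
    proof (intro ballI impI)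
      fix \<psi> assume "\<psi> \<in> f ` \<C>"
      then show "\<not> cozero_set X \<psi> \<subseteq> cozero_set X \<phi>0" using neg sub by blast
    qed
    moreover have "f ` \<C> \<subseteq> \<Phi>" "countable (f ` \<C>)" using f \<C>(1) by auto
    ultimately have "\<exists>\<phi>\<in>\<Phi>. cozero_set X \<phi> \<noteq> {} \<and> unrefined_by X (f ` \<C>) \<phi>"
      using refl(2) \<phi>0(1) ne unfolding reflecting_def by blast
    then obtain \<phi> where \<phi>: "\<phi> \<in> \<Phi>" "cozero_set X \<phi> \<noteq> {}" "unrefined_by X (f ` \<C>) \<phi>" by (elim bexE conjE)
    have "N \<phi> \<noteq> {}" using \<phi>(2) unfolding N[OF \<phi>(1)] by blast
    then obtain C where C: "C \<in> \<C>" "C \<subseteq> N \<phi>" using \<C>(2) Nop[OF \<phi>(1)] unfolding pi_base_def by metis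
    have fC: "f C \<in> \<Phi>" "N (f C) \<subseteq> C" using f C(1) by blast+
    have "cozero_set X (f C) \<subseteq> cozero_set X \<phi>"
    proof
      fix x assume x: "x \<in> cozero_set X (f C)"
      then have "evaluation \<Phi> x \<in> N \<phi>" using N[OF fC(1)] fC(2) C(2) by blast
      then have "\<phi> x \<noteq> 0" using \<phi>(1) by (simp add: N_def evaluation_def)
      then show "x \<in> cozero_set X \<phi>" using x by (simp add: cozero_set_def)
    qed
    then show False using \<phi>(3) fne[OF C(1)] C(1) by (simp add: unrefined_by_def)
  qed
  moreover have "openin X (cozero_set X (f C)) \<and> cozero_set X (f C) \<noteq> {}" if "C \<in> \<C>" for C
  proof
    have "continuous_map X euclidean (f C)" using f cont that by blast
    then show "openin X (cozero_set X (f C))" by (rule openin_cozero_set)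
  qed (rule fne[OF that])
  ultimately have "pi_base X ((\<lambda>C. cozero_set X (f C)) ` \<C>)" unfolding pi_base_def by simp
  moreover have "countable ((\<lambda>C. cozero_set X (f C)) ` \<C>)" using \<C>(1) by simp
  ultimately show ?thesis by (intro exI conjI)
qed

section \<open>From cardinal functions to countable families\<close>
lemma densely_k_separable_imp_dense_sets_k_separable:
  fixes X :: "'a topology"
  assumes "densely_k_separable X"
  shows "dense_sets_k_separable X"
  unfolding dense_sets_k_separable_def
proof (intro allI impI)
  fix Y assume Y: "dense_subset X Y"
  define W where "W = subtopology X Y"
  have topW: "topspace W = Y" using Y by (auto simp: W_def dense_subset_def)
  have "d_k W \<le>o \<delta>_k X"
    unfolding \<delta>_k_def W_def by (rule sup_card_least_upper(2)) (use Y Card_order_d_k in auto)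
  then have dW: "d_k W \<le>o natLeq"
    using assms ordLeq_transitive unfolding densely_k_separable_def by blast
  have "d_k W \<in> {cov_k (subtopology W D) |D. dense_subset W D}"
    unfolding d_k_def
  proof (rule min_card_least(1))
    show "{cov_k (subtopology W D) |D. dense_subset W D} \<noteq> {}" using dense_subset_topspace by blast
  qed (auto simp: Card_order_cov_k)
  then obtain D where D: "d_k W = cov_k (subtopology W D)" "dense_subset W D" by blast
  have "cov_k (subtopology W D) \<in> {|\<K>| |\<K>. (\<forall>K\<in>\<K>. compactin (subtopology W D) K) \<and> \<Union>\<K> = topspace (subtopology W D)}"
    unfolding cov_k_def by (rule min_card_least(1)[OF cov_k_set_nonempty]) (auto simp: card_of_Card_order)
  then obtain \<K> where \<K>: "cov_k (subtopology W D) = |\<K>|" "\<forall>K\<in>\<K>. compactin (subtopology W D) K"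
    "\<Union>\<K> = topspace (subtopology W D)" by (elim CollectE exE conjE)
  have DY: "D \<subseteq> Y" using D(2) topW by (simp add: dense_subset_def)
  have UK: "\<Union>\<K> = D" using \<K>(3) DY topW by auto
  have "countable \<K>" using dW D(1) \<K>(1) by (simp add: countable_card_le_natLeq)
  moreover have "compactin X K \<and> K \<subseteq> Y" if "K \<in> \<K>" for K
    using \<K>(2) that by (auto simp: W_def compactin_subtopology)
  moreover have "dense_subset X (\<Union>\<K>)"
    unfolding UK dense_subset_iff
  proof (intro conjI allI impI)
    show "D \<subseteq> topspace X" using DY Y by (auto simp: dense_subset_def)
    fix U assume U: "openin X U" "U \<noteq> {}"
    have "U \<inter> Y \<noteq> {}" using Y U by (simp add: dense_subset_iff)
    moreover have "openin W (U \<inter> Y)" unfolding W_def by (rule openin_subtopology_Int[OF U(1)])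
    ultimately have "(U \<inter> Y) \<inter> D \<noteq> {}" using D(2) by (simp add: dense_subset_iff)
    then show "U \<inter> D \<noteq> {}" by blast
  qed
  ultimately show "\<exists>\<K>. countable \<K> \<and> (\<forall>K\<in>\<K>. compactin X K \<and> K \<subseteq> Y) \<and> dense_subset X (\<Union>\<K>)"
    by (intro exI[of _ \<K>]) simp
qed

lemma countable_pi_base_imp_d_k_le:
  fixes X :: "'a topology"
  assumes \<B>: "countable \<B>" "pi_base X \<B>" and Y: "dense_subset X Y"
  shows "\<exists>\<K> :: 'a set set. countable \<K> \<and> d_k (subtopology X Y) \<le>o |\<K>|"
proof -
  define W where "W = subtopology X Y"
  have topW: "topspace W = Y" using Y by (auto simp: W_def dense_subset_def)
  have "\<forall>B\<in>\<B>. \<exists>y. y \<in> B \<inter> Y"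
  proof
    fix B assume "B \<in> \<B>"
    then have "openin X B" "B \<noteq> {}" using \<B>(2) by (simp_all add: pi_base_def)
    then have "B \<inter> Y \<noteq> {}" using Y by (simp add: dense_subset_iff)
    then show "\<exists>y. y \<in> B \<inter> Y" by blast
  qed
  from bchoice[OF this] obtain y where y: "\<forall>B\<in>\<B>. y B \<in> B \<inter> Y" by (elim exE)
  define D where "D = y ` \<B>"
  have DY: "D \<subseteq> Y" using y by (auto simp: D_def)
  have D: "dense_subset W D"
    unfolding dense_subset_iff topW
  proof (intro conjI allI impI)
    show "D \<subseteq> Y" by (rule DY)
    fix V assume V: "openin W V" "V \<noteq> {}"
    then obtain U where U: "openin X U" "V = U \<inter> Y" by (auto simp: W_def openin_subtopology)
    then have "U \<noteq> {}" using V(2) by blast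
    then obtain B where B: "B \<in> \<B>" "B \<subseteq> U" using \<B>(2) U(1) unfolding pi_base_def by metis
    then have "y B \<in> V \<inter> D" using y U(2) by (auto simp: D_def)
    then show "V \<inter> D \<noteq> {}" by blast
  qed
  define \<K> where "\<K> = (\<lambda>d. {d}) ` D"
  have topD: "topspace (subtopology W D) = D" using DY topW by auto
  have "\<forall>K\<in>\<K>. compactin (subtopology W D) K" using topD by (auto simp: \<K>_def)
  moreover have "\<Union>\<K> = topspace (subtopology W D)" unfolding topD by (auto simp: \<K>_def)
  ultimately have "cov_k (subtopology W D) \<le>o |\<K>|"
    unfolding cov_k_def
    by (intro min_card_least(2)[OF cov_k_set_nonempty]) (auto simp: card_of_Card_order)
  moreover have "d_k W \<le>o cov_k (subtopology W D)"
    unfolding d_k_def by (rule min_card_least(2)) (use D Card_order_cov_k in auto)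
  ultimately have "d_k W \<le>o |\<K>|" using ordLeq_transitive by blast
  moreover have "countable \<K>" using \<B>(1) by (simp add: \<K>_def D_def)
  ultimately show ?thesis unfolding W_def by blast
qed

text \<open>
  The supremum is formed among cardinals on \<open>'a set\<close>, so the bound has to be represented on that type: by a
  countably infinite set if the type is infinite, and by the whole type otherwise.
\<close>
lemma countable_pi_base_imp_densely_k_separable:
  fixes X :: "'a topology"
  assumes \<B>: "countable \<B>" "pi_base X \<B>"
  shows "densely_k_separable X"
proof -
  have "\<exists>N :: 'a set set. countable N \<and> (\<forall>\<K> :: 'a set set. countable \<K> \<longrightarrow> |\<K>| \<le>o |N| )"
  proof (cases "finite (UNIV :: 'a set set)")
    case True
    then show ?thesis by (intro exI[of _ UNIV]) (simp add: countable_finite card_of_mono1)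
  next
    case False
    then obtain N :: "'a set set" where N: "countable N" "infinite N"
      using infinite_countable_subset' by blast
    have "natLeq \<le>o |N|" using infinite_iff_natLeq_ordLeq[of N] N(2) by blast
    then have "|\<K>| \<le>o |N|" if "countable \<K>" for \<K> :: "'a set set"
      using ordLeq_transitive that[unfolded countable_card_le_natLeq] by blast
    then show ?thesis using N(1) by blast
  qed
  then obtain N :: "'a set set" where N: "countable N" "\<forall>\<K> :: 'a set set. countable \<K> \<longrightarrow> |\<K>| \<le>o |N|"
    by (elim exE conjE)
  have "\<delta>_k X \<le>o |N|"
    unfolding \<delta>_k_def
  proof (rule sup_card_least_upper(3))
    show "Card_order r" if "r \<in> {d_k (subtopology X Y) |Y. dense_subset X Y}" for r
      using that Card_order_d_k by blast
    show "Card_order |N|" by (rule card_of_Card_order)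
    fix r assume "r \<in> {d_k (subtopology X Y) |Y. dense_subset X Y}"
    then obtain Y where Y: "r = d_k (subtopology X Y)" "dense_subset X Y" by blast
    from countable_pi_base_imp_d_k_le[OF \<B> Y(2)] N(2)
    show "r \<le>o |N|" unfolding Y(1) using ordLeq_transitive by blast
  qed
  then show ?thesis using N(1) ordLeq_transitive
    unfolding densely_k_separable_def countable_card_le_natLeq by blast
qed

lemma pi_weight_countable_iff:
  "pi_weight X \<le>o natLeq \<longleftrightarrow> (\<exists>\<B>. countable \<B> \<and> pi_base X \<B>)"
proof
  let ?R = "{|\<B>| |\<B>. pi_base X \<B>}"
  have ne: "?R \<noteq> {}" using pi_base_nonempty_opens by blast
  have co: "Card_order r" if "r \<in> ?R" for r using that card_of_Card_order by blast
  show "\<exists>\<B>. countable \<B> \<and> pi_base X \<B>" if "pi_weight X \<le>o natLeq"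
  proof -
    have "pi_weight X \<in> ?R" unfolding pi_weight_def by (rule min_card_least(1)[OF ne co])
    then show ?thesis using that by (auto simp: countable_card_le_natLeq)
  qed
  show "pi_weight X \<le>o natLeq" if "\<exists>\<B>. countable \<B> \<and> pi_base X \<B>"
  proof -
    from that obtain \<B> where \<B>: "countable \<B>" "pi_base X \<B>" by (elim exE conjE)
    have "pi_weight X \<le>o |\<B>|"
      unfolding pi_weight_def by (rule min_card_least(2)[OF ne co]) (use \<B>(2) in auto)
    then show ?thesis using \<B>(1) ordLeq_transitive unfolding countable_card_le_natLeq by blast
  qed
qed

theorem theorem3p2:
  fixes X :: "'a topology"
  assumes "compact_space X" and "Hausdorff_space X"
  shows "densely_k_separable X \<longleftrightarrow> pi_weight X \<le>o natLeq"
proof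
  assume "densely_k_separable X"
  then have "dense_sets_k_separable X" by (rule densely_k_separable_imp_dense_sets_k_separable)
  then show "pi_weight X \<le>o natLeq"
    unfolding pi_weight_countable_iff by (rule k_separable_imp_countable_pi_base[OF assms])
next
  assume "pi_weight X \<le>o natLeq"
  then obtain \<B> where "countable \<B>" "pi_base X \<B>" unfolding pi_weight_countable_iff by (elim exE conjE)
  then show "densely_k_separable X" by (rule countable_pi_base_imp_densely_k_separable)
qed

end
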